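(* Let $F=\left\{ \begin{pmatrix}1&0\\0&1\end{pmatrix},\begin{pmatrix}-1&0\\0&1\end{pmatrix}\right\}\subseteq \mathrm{GL}_2(\mathbb{R})$ and let $\Gamma\subseteq\mathbb{R}^2\rtimes F$ be the torsion free, discrete and uniform subgroup generated by $$a=\left(\begin{pmatrix}1\\0\end{pmatrix},\begin{pmatrix}1&0\\0&1\end{pmatrix}\right)\quad\text{and}\quad b=\left(\begin{pmatrix}0\\ \frac12\end{pmatrix},\begin{pmatrix}-1&0\\0&1\end{pmatrix}\right),$$ so that $\Gamma\backslash\mathbb{R}^2$ is the Klein bottle. Let $\alpha:\mathbb{R}^2\to\mathbb{R}^2$ be the affine map $\alpha(x,y)=(3x+\frac12,\,3y)$. Then $\alpha\Gamma\alpha^{-1}\subseteq\Gamma$, the induced map $\bar\alpha:\Gamma\backslash\mathbb{R}^2\to\Gamma\backslash\mathbb{R}^2:\ \Gamma\cdot v\mapsto\Gamma\cdot\alpha(v)$ is an expanding map, and $\bar\alpha$ is not topologically conjugate to any infra-nilmanifold endomorphism of $\Gamma\backslash\mathbb{R}^2$.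
   Context: The group $\mathrm{Aff}(\mathbb{R}^2)=\mathbb{R}^2\rtimes\mathrm{GL}_2(\mathbb{R})$ acts on $\mathbb{R}^2$ by $(v,A)\cdot x=v+Ax$; the conjugation $\alpha\Gamma\alpha^{-1}$ takes place in $\mathrm{Aff}(\mathbb{R}^2)$, and $F$ is identified with $\{0\}\times F$. Infra-nilmanifold endomorphism of $\Gamma\backslash\mathbb{R}^2$: a map of the form $\bar\varphi:\Gamma\backslash\mathbb{R}^2\to\Gamma\backslash\mathbb{R}^2:\ \Gamma\cdot v\mapsto\Gamma\cdot\varphi(v)$, where $\varphi$ is an automorphism of the Lie group $\mathbb{R}^2\rtimes F$ with $\varphi(F)=F$ and $\varphi(\Gamma)\subseteq\Gamma$ (then automatically $\varphi(\mathbb{R}^2)=\mathbb{R}^2$, and $\varphi(v)$ refers to the restriction of $\varphi$ to $\mathbb{R}^2$). A $C^1$ map $f:M\to M$ of a compact manifold is expanding if for some (equivalently any) Riemannian metric there are constants $c>0$, $\lambda>1$ with $\|Df^k(v)\|\ge c\lambda^k\|v\|$ for all tangent vectors $v$ and all integers $k\geq 1$. Two maps $f:X\to X$ and $g:Y\to Y$ are topologically conjugate if there is a homeomorphism $h:X\to Y$ with $h\circ f=g\circ h$. *)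

theory Defs
  imports "HOL-Analysis.Analysis" "HOL-Algebra.Generated_Groups"
begin

section \<open>Quotient spaces\<close>

definition quotient_topology :: "'a topology \<Rightarrow> ('a \<Rightarrow> 'b) \<Rightarrow> 'b topology" where
  "quotient_topology X q =
     topology (\<lambda>U. U \<subseteq> q ` topspace X \<and> openin X {x \<in> topspace X. q x \<in> U})"

lemma openin_quotient_topology:
  "openin (quotient_topology X q) U \<longleftrightarrow>
     U \<subseteq> q ` topspace X \<and> openin X {x \<in> topspace X. q x \<in> U}"
proof -
  have "istopology (\<lambda>U. U \<subseteq> q ` topspace X \<and> openin X {x \<in> topspace X. q x \<in> U})"
    unfolding istopology_def
  proof (intro conjI allI impI)
    fix S T
    assume S: "S \<subseteq> q ` topspace X \<and> openin X {x \<in> topspace X. q x \<in> S}"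
      and T: "T \<subseteq> q ` topspace X \<and> openin X {x \<in> topspace X. q x \<in> T}"
    have "{x \<in> topspace X. q x \<in> S \<inter> T} =
        {x \<in> topspace X. q x \<in> S} \<inter> {x \<in> topspace X. q x \<in> T}"
      by blast
    with S T show "openin X {x \<in> topspace X. q x \<in> S \<inter> T}"
      by (simp only: openin_Int)
    from S show "S \<inter> T \<subseteq> q ` topspace X" by blast
  next
    fix K
    assume K: "\<forall>U\<in>K. U \<subseteq> q ` topspace X \<and> openin X {x \<in> topspace X. q x \<in> U}"
    then show "\<Union>K \<subseteq> q ` topspace X" by blast
    have "openin X (\<Union>U\<in>K. {x \<in> topspace X. q x \<in> U})"
      using K by (intro openin_Union) blast
    moreover have "{x \<in> topspace X. q x \<in> \<Union>K} = (\<Union>U\<in>K. {x \<in> topspace X. q x \<in> U})"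
      by blast
    ultimately show "openin X {x \<in> topspace X. q x \<in> \<Union>K}" by simp
  qed
  then show ?thesis
    by (simp add: quotient_topology_def topology_inverse')
qed

lemma topspace_quotient_topology [simp]: "topspace (quotient_topology X q) = q ` topspace X"
proof
  show "topspace (quotient_topology X q) \<subseteq> q ` topspace X"
    using openin_topspace[of "quotient_topology X q"] by (simp only: openin_quotient_topology)
  have "{x \<in> topspace X. q x \<in> q ` topspace X} = topspace X" by auto
  then have "openin (quotient_topology X q) (q ` topspace X)"
    by (simp add: openin_quotient_topology)
  then show "q ` topspace X \<subseteq> topspace (quotient_topology X q)"
    by (rule openin_subset)
qed

lemma quotient_map_quotient_topology: "quotient_map X (quotient_topology X q) q"
  by (simp add: quotient_map_def openin_quotient_topology)

definition topologically_conjugate ::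
  "'a topology \<Rightarrow> ('a \<Rightarrow> 'a) \<Rightarrow> 'b topology \<Rightarrow> ('b \<Rightarrow> 'b) \<Rightarrow> bool" where
  "topologically_conjugate X f Y g \<longleftrightarrow>
     (\<exists>h. homeomorphic_map X Y h \<and> (\<forall>x\<in>topspace X. h (f x) = g (h x)))"

text \<open>The unit square with \<open>(0, t) \<sim> (1, t)\<close> and \<open>(s, 0) \<sim> (1 - s, 1)\<close>.\<close>

definition klein_glue :: "((real \<times> real) \<times> (real \<times> real)) set" where
  "klein_glue = {((0, t), (1, t)) |t. 0 \<le> t \<and> t \<le> 1} \<union> {((s, 0), (1 - s, 1)) |s. 0 \<le> s \<and> s \<le> 1}"

definition klein_bottle :: "(real \<times> real) set topology" where
  "klein_bottle = quotient_topology (top_of_set ({0..1} \<times> {0..1}))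
     (\<lambda>p. (klein_glue \<union> klein_glue\<inverse>)\<^sup>* `` {p})"

section \<open>Smooth manifolds and expanding maps\<close>

text \<open>Only used for open \<open>S\<close>. As the domain is finite-dimensional, continuity of all
  directional derivatives is continuity of the derivative.\<close>

primrec Ck_on :: "nat \<Rightarrow> ('a::euclidean_space \<Rightarrow> 'b::real_normed_vector) \<Rightarrow> 'a set \<Rightarrow> bool" where
  "Ck_on 0 f S \<longleftrightarrow> continuous_on S f"
| "Ck_on (Suc k) f S \<longleftrightarrow> (\<forall>x\<in>S. f differentiable (at x)) \<and>
     (\<forall>v. Ck_on k (\<lambda>x. frechet_derivative f (at x) v) S)"

definition smooth_on :: "('a::euclidean_space \<Rightarrow> 'b::real_normed_vector) \<Rightarrow> 'a set \<Rightarrow> bool" where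
  "smooth_on f S \<longleftrightarrow> (\<forall>k. Ck_on k f S)"

text \<open>A chart consists of its domain and its coordinate map.\<close>

type_synonym ('p, 'e) chart = "'p set \<times> ('p \<Rightarrow> 'e)"

abbreviation chart_inv :: "('p, 'e) chart \<Rightarrow> 'e \<Rightarrow> 'p" where
  "chart_inv c \<equiv> inv_into (fst c) (snd c)"

definition smooth_manifold :: "'p topology \<Rightarrow> ('p, 'e::euclidean_space) chart set \<Rightarrow> bool" where
  "smooth_manifold X \<A> \<longleftrightarrow>
     Hausdorff_space X \<and> second_countable X \<and> (\<Union>c\<in>\<A>. fst c) = topspace X \<and>
     (\<forall>c\<in>\<A>. openin X (fst c) \<and> open (snd c ` fst c) \<and>
        homeomorphic_map (subtopology X (fst c)) (top_of_set (snd c ` fst c)) (snd c)) \<and>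
     (\<forall>c\<in>\<A>. \<forall>d\<in>\<A>. smooth_on (snd d \<circ> chart_inv c) (snd c ` (fst c \<inter> fst d)))"

definition local_rep ::
  "('p \<Rightarrow> 'q) \<Rightarrow> ('p, 'e) chart \<Rightarrow> ('q, 'f) chart \<Rightarrow> 'e \<Rightarrow> 'f" where
  "local_rep f c d = snd d \<circ> f \<circ> chart_inv c"

definition Ck_map :: "nat \<Rightarrow> 'p topology \<Rightarrow> ('p, 'e::euclidean_space) chart set \<Rightarrow>
    'q topology \<Rightarrow> ('q, 'f::euclidean_space) chart set \<Rightarrow> ('p \<Rightarrow> 'q) \<Rightarrow> bool" where
  "Ck_map k X \<A> Y \<B> f \<longleftrightarrow> continuous_map X Y f \<and>
     (\<forall>c\<in>\<A>. \<forall>d\<in>\<B>. Ck_on k (local_rep f c d) (snd c ` {p \<in> fst c. f p \<in> fst d}))"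

definition diffeomorphism :: "'p topology \<Rightarrow> ('p, 'e::euclidean_space) chart set \<Rightarrow>
    'q topology \<Rightarrow> ('q, 'f::euclidean_space) chart set \<Rightarrow> ('p \<Rightarrow> 'q) \<Rightarrow> bool" where
  "diffeomorphism X \<A> Y \<B> f \<longleftrightarrow> bij_betw f (topspace X) (topspace Y) \<and>
     (\<forall>k. Ck_map k X \<A> Y \<B> f) \<and> (\<forall>k. Ck_map k Y \<B> X \<A> (inv_into (topspace X) f))"

text \<open>A tangent vector at \<open>p\<close> is given by its coordinates \<open>v\<close> in a chart \<open>c\<close> around \<open>p\<close>;
  the differential of \<open>f\<close> sends it to the vector with coordinates \<open>tangent_rep f c d p v\<close>
  in a chart \<open>d\<close> around \<open>f p\<close>. A Riemannian metric is given by its inner products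
  \<open>g c p\<close> in the coordinates of each chart \<open>c\<close>, compatible under change of charts.\<close>

definition tangent_rep :: "('p \<Rightarrow> 'q) \<Rightarrow> ('p, 'e::euclidean_space) chart \<Rightarrow>
    ('q, 'f::euclidean_space) chart \<Rightarrow> 'p \<Rightarrow> 'e \<Rightarrow> 'f" where
  "tangent_rep f c d p = frechet_derivative (local_rep f c d) (at (snd c p))"

definition riemannian_metric :: "('p, 'e::euclidean_space) chart set \<Rightarrow>
    (('p, 'e) chart \<Rightarrow> 'p \<Rightarrow> 'e \<Rightarrow> 'e \<Rightarrow> real) \<Rightarrow> bool" where
  "riemannian_metric \<A> g \<longleftrightarrow>
     (\<forall>c\<in>\<A>. \<forall>p\<in>fst c. bilinear (g c p) \<and> (\<forall>v w. g c p v w = g c p w v) \<and>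
        (\<forall>v. v \<noteq> 0 \<longrightarrow> g c p v v > 0)) \<and>
     (\<forall>c\<in>\<A>. \<forall>v w. smooth_on (\<lambda>x. g c (chart_inv c x) v w) (snd c ` fst c)) \<and>
     (\<forall>c\<in>\<A>. \<forall>d\<in>\<A>. \<forall>p\<in>fst c \<inter> fst d. \<forall>v w.
        g c p v w = g d p (tangent_rep id c d p v) (tangent_rep id c d p w))"

definition expanding_map ::
  "'p topology \<Rightarrow> ('p, 'e::euclidean_space) chart set \<Rightarrow> ('p \<Rightarrow> 'p) \<Rightarrow> bool" where
  "expanding_map X \<A> f \<longleftrightarrow>
     compact_space X \<and> smooth_manifold X \<A> \<and> Ck_map 1 X \<A> X \<A> f \<and>
     (\<exists>g C L. riemannian_metric \<A> g \<and> C > 0 \<and> L > 1 \<and>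
        (\<forall>k\<ge>1. \<forall>c\<in>\<A>. \<forall>d\<in>\<A>. \<forall>p\<in>fst c. (f ^^ k) p \<in> fst d \<longrightarrow>
           (\<forall>v. let w = tangent_rep (f ^^ k) c d p v
                in sqrt (g d ((f ^^ k) p) w w) \<ge> C * L ^ k * sqrt (g c p v v))))"

section \<open>Affine groups and infra-nilmanifold endomorphisms\<close>

definition Aff :: "((real^'n) \<times> (real^'n^'n)) monoid" where
  "Aff = \<lparr>carrier = UNIV \<times> {A. invertible A},
          monoid.mult = (\<lambda>(v, A) (w, B). (v + A *v w, A ** B)),
          one = (0, mat 1)\<rparr>"

definition aff_act :: "(real^'n) \<times> (real^'n^'n) \<Rightarrow> real^'n \<Rightarrow> real^'n" where
  "aff_act = (\<lambda>(v, A) x. v + A *v x)"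

text \<open>The subgroup \<open>\<real>\<^sup>n \<rtimes> F\<close> for a subgroup \<open>F\<close> of \<open>GL\<^sub>n(\<real>)\<close>.\<close>

definition semidirect :: "(real^'n^'n) set \<Rightarrow> ((real^'n) \<times> (real^'n^'n)) monoid" where
  "semidirect F = Aff\<lparr>carrier := UNIV \<times> F\<rparr>"

definition semidirect_top :: "(real^'n^'n) set \<Rightarrow> ((real^'n) \<times> (real^'n^'n)) topology" where
  "semidirect_top F = top_of_set (UNIV \<times> F)"

text \<open>For finite \<open>F\<close> the Lie group \<open>\<real>\<^sup>n \<rtimes> F\<close> is a disjoint union of copies of \<open>\<real>\<^sup>n\<close>.\<close>

definition semidirect_atlas ::
  "(real^'n^'n) set \<Rightarrow> ((real^'n) \<times> (real^'n^'n), real^'n) chart set" where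
  "semidirect_atlas F = {(V \<times> {A}, fst) |V A. open V \<and> A \<in> F}"

definition lie_automorphism ::
  "(real^'n^'n) set \<Rightarrow> ((real^'n) \<times> (real^'n^'n) \<Rightarrow> (real^'n) \<times> (real^'n^'n)) \<Rightarrow> bool" where
  "lie_automorphism F \<phi> \<longleftrightarrow> \<phi> \<in> iso (semidirect F) (semidirect F) \<and>
     diffeomorphism (semidirect_top F) (semidirect_atlas F)
       (semidirect_top F) (semidirect_atlas F) \<phi>"

definition torsion_free :: "('a, 'b) monoid_scheme \<Rightarrow> 'a set \<Rightarrow> bool" where
  "torsion_free G \<Gamma> \<longleftrightarrow>
     (\<forall>\<gamma>\<in>\<Gamma>. \<forall>n::nat. n > 0 \<and> \<gamma> [^]\<^bsub>G\<^esub> n = \<one>\<^bsub>G\<^esub> \<longrightarrow> \<gamma> = \<one>\<^bsub>G\<^esub>)"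

definition discrete_in :: "'a topology \<Rightarrow> 'a set \<Rightarrow> bool" where
  "discrete_in T \<Gamma> \<longleftrightarrow> subtopology T \<Gamma> = discrete_topology \<Gamma>"

definition uniform_in :: "('a, 'b) monoid_scheme \<Rightarrow> 'a topology \<Rightarrow> 'a set \<Rightarrow> bool" where
  "uniform_in G T \<Gamma> \<longleftrightarrow> compact_space (quotient_topology T (\<lambda>g. \<Gamma> #>\<^bsub>G\<^esub> g))"

definition aff_orbit :: "((real^'n) \<times> (real^'n^'n)) set \<Rightarrow> real^'n \<Rightarrow> (real^'n) set" where
  "aff_orbit \<Gamma> v = (\<lambda>\<gamma>. aff_act \<gamma> v) ` \<Gamma>"

definition orbit_space :: "((real^'n) \<times> (real^'n^'n)) set \<Rightarrow> (real^'n) set topology" where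
  "orbit_space \<Gamma> = quotient_topology euclidean (aff_orbit \<Gamma>)"

text \<open>The charts of \<open>\<Gamma>\<setminus>\<real>\<^sup>n\<close> are the local inverses of the projection.\<close>

definition orbit_atlas ::
  "((real^'n) \<times> (real^'n^'n)) set \<Rightarrow> ((real^'n) set, real^'n) chart set" where
  "orbit_atlas \<Gamma> = {(aff_orbit \<Gamma> ` V, inv_into V (aff_orbit \<Gamma>)) |V.
     open V \<and> inj_on (aff_orbit \<Gamma>) V}"

text \<open>The union is a single orbit exactly when \<open>f\<close> descends to a map on orbits.\<close>

definition induced_map :: "((real^'n) \<times> (real^'n^'n)) set \<Rightarrow>
    (real^'n \<Rightarrow> real^'n) \<Rightarrow> (real^'n) set \<Rightarrow> (real^'n) set" where
  "induced_map \<Gamma> f X = (\<Union>v\<in>X. aff_orbit \<Gamma> (f v))"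

definition infra_nil_endomorphism :: "(real^'n^'n) set \<Rightarrow>
    ((real^'n) \<times> (real^'n^'n)) set \<Rightarrow> ((real^'n) set \<Rightarrow> (real^'n) set) \<Rightarrow> bool" where
  "infra_nil_endomorphism F \<Gamma> f \<longleftrightarrow>
     (\<exists>\<phi>. lie_automorphism F \<phi> \<and> \<phi> ` ({0} \<times> F) = {0} \<times> F \<and> \<phi> ` \<Gamma> \<subseteq> \<Gamma> \<and>
        (\<forall>v. f (aff_orbit \<Gamma> v) = aff_orbit \<Gamma> (fst (\<phi> (v, mat 1)))))"

end

theory Submission
  imports Defs
begin

text \<open>
  Every element of the group \<open>\<Gamma>\<close> is \<open>a\<^sup>nb\<^sup>k\<close>, acting by \<open>(x, y) \<mapsto> (\<plusminus>x + n, y + k/2)\<close> with the sign of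
  the parity of \<open>k\<close>. Distinct translates of a point are at distance at least \<open>1/2\<close>, which makes the
  action free and properly discontinuous, and \<open>[0,1] \<times> [0,1/2]\<close> meets every orbit; gluing its
  boundary gives the Klein bottle. Conjugation by \<open>\<alpha>\<close> sends \<open>a\<close> to \<open>a\<^sup>3\<close> and \<open>b\<close> to \<open>ab\<^sup>3\<close>. As
  \<open>\<Gamma>\<close> acts by isometries, the Euclidean metric descends to the quotient, and the \<open>j\<close>-th iterate of the
  induced map stretches every tangent vector by \<open>3\<^sup>j\<close> (\<open>expanding_map_homothety\<close>).

  The obstruction to being conjugate to an infra-nilmanifold endomorphism lives in
  \<open>H\<^sub>1(\<Gamma>; \<int>/2)\<close>, which is \<open>(\<int>/2)\<^sup>2\<close> with basis the classes of \<open>a\<close> and \<open>b\<close>. An endomorphism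
  given by an automorphism that preserves \<open>F\<close> acts on it by a diagonal matrix, since it preserves both
  coordinate axes (\<open>klein_endomorphism_lift\<close>), whereas \<open>\<alpha>\<close> acts by the nontrivial unipotent matrix
  fixing \<open>a\<close> and sending \<open>b\<close> to \<open>a + b\<close>. A diagonal matrix over \<open>\<int>/2\<close> is idempotent and this
  unipotent one is not, so they are not conjugate.

  To see this action topologically, the quotient is embedded in \<open>\<real> \<times> \<complex> \<times> \<complex>\<close> by invariant trigonometric
  functions (\<open>kemb_eq_iff\<close>). The plane covers the image (\<open>covering_space_kemb\<close>), so a conjugating
  homeomorphism and its inverse lift to the plane (\<open>lift_to_plane\<close>). Two lifts of the same map differ
  by a group element (\<open>lifts_differ_by_kact\<close>), hence the lifts intertwine the group with itself and
  the lifts of the two maps with each other; comparing coordinates modulo 2 in the resulting relations is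
  the argument above in elementary form (\<open>not_conjugate_infra_nil_endomorphism\<close>).
\<close>

section \<open>The Klein bottle group in coordinates\<close>

definition flip :: "int \<Rightarrow> int" where
  "flip k = (if even k then 1 else -1)"

lemma flip_simps [simp]:
  "flip 0 = 1" "flip 1 = -1" "flip (-k) = flip k" "flip (3 * k) = flip k" "flip k * flip k = 1"
  by (auto simp: flip_def)

lemma flip_add: "flip (k + l) = flip k * flip l"
  by (auto simp: flip_def)

lemma flip_cases: "flip k = 1 \<or> flip k = -1"
  by (auto simp: flip_def)

lemma odd_flip [simp]: "odd (flip k)"
  by (auto simp: flip_def)

abbreviation diag_mat :: "real \<Rightarrow> real \<Rightarrow> real^2^2" where
  "diag_mat s t \<equiv> vector [vector [s, 0], vector [0, t]]"

definition holonomy :: "(real^2^2) set" where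
  "holonomy = {diag_mat 1 1, diag_mat (-1) 1}"

text \<open>In terms of the generators, \<open>klein_elt n k\<close> is \<open>a\<^sup>nb\<^sup>k\<close>. The sign \<open>flip k\<close> records the
  orientation character and makes the product \<open>(n, k)(m, l) = (n + flip k * m, k + l)\<close>; as
  \<open>flip k\<close> is odd, reducing both coordinates modulo 2 is a homomorphism.\<close>

definition klein_elt :: "int \<Rightarrow> int \<Rightarrow> (real^2) \<times> (real^2^2)" where
  "klein_elt n k = (vector [of_int n, of_int k / 2], diag_mat (of_int (flip k)) 1)"

definition klein_group :: "((real^2) \<times> (real^2^2)) set" where
  "klein_group = {klein_elt n k |n k. True}"

lemma klein_elt_mem [simp, intro]: "klein_elt n k \<in> klein_group"
  by (auto simp: klein_group_def)

lemma klein_group_cases [elim]: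
  assumes "\<gamma> \<in> klein_group" obtains n k where "\<gamma> = klein_elt n k"
  using assms by (auto simp: klein_group_def)

abbreviation kact :: "int \<Rightarrow> int \<Rightarrow> real^2 \<Rightarrow> real^2" where
  "kact n k \<equiv> aff_act (klein_elt n k)"

lemma vec2_eq_iff: "(u :: 'a^2) = v \<longleftrightarrow> u $ 1 = v $ 1 \<and> u $ 2 = v $ 2"
  by (simp add: vec_eq_iff forall_2)

lemma diag_mat_mult: "diag_mat s t ** diag_mat s' t' = diag_mat (s * s') (t * t')"
  by (simp add: vec2_eq_iff matrix_matrix_mult_def sum_2)

lemma diag_mat_vec: "diag_mat s t *v v = vector [s * v $ 1, t * v $ 2]"
  by (simp add: vec2_eq_iff matrix_vector_mult_def sum_2)

lemma mat_1_eq_diag: "(mat 1 :: real^2^2) = diag_mat 1 1"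
  by (simp add: vec2_eq_iff mat_def)

lemma diag_mat_eq_iff [simp]: "diag_mat s t = diag_mat s' t' \<longleftrightarrow> s = s' \<and> t = t'"
  by (auto simp: vec2_eq_iff)

lemma invertible_diag_mat: "s \<noteq> 0 \<Longrightarrow> t \<noteq> 0 \<Longrightarrow> invertible (diag_mat s t)"
  by (auto simp: invertible_def mat_1_eq_diag diag_mat_mult
      intro!: exI[of _ "diag_mat (1 / s) (1 / t)"])

lemma kact_nth [simp]:
  "kact n k v $ 1 = of_int (flip k) * v $ 1 + of_int n"
  "kact n k v $ 2 = v $ 2 + of_int k / 2"
  by (simp_all add: aff_act_def klein_elt_def diag_mat_vec)

lemma kact_kact: "kact n k (kact m l v) = kact (n + flip k * m) (k + l) v"
  by (simp add: vec2_eq_iff flip_add algebra_simps add_divide_distrib)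

lemma kact_0 [simp]: "kact 0 0 v = v"
  by (simp add: vec2_eq_iff)

lemma kact_inverse: "kact (- flip k * n) (- k) (kact n k v) = v"
  by (simp add: kact_kact flip_add mult.assoc)

lemma abs_nth_diff_le_dist: "\<bar>u $ i - v $ i\<bar> \<le> dist u (v :: real^2)"
  by (metis component_le_norm_cart dist_norm vector_minus_component real_norm_def)

text \<open>Freeness and proper discontinuity of the action in one quantitative form: \<open>k\<close> can be read off
  from the second coordinate up to an error below \<open>1/2\<close>, and once \<open>k\<close> is known the two group
  elements differ by a horizontal integer translation.\<close>

lemma kact_separated:
  assumes "dist (kact n k v) (kact m l v) < 1/2"
  shows "n = m \<and> k = l"
proof -
  have "\<bar>of_int k / 2 - of_int l / (2::real)\<bar> < 1/2"
    using abs_nth_diff_le_dist[of "kact n k v" 2 "kact m l v"] assms by simp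
  then have "\<bar>of_int (k - l) :: real\<bar> < 1" by (simp add: abs_if field_simps split: if_splits)
  then have k: "k = l" by linarith
  have "\<bar>of_int (n - m) :: real\<bar> < 1"
    using abs_nth_diff_le_dist[of "kact n k v" 1 "kact m l v"] assms k by simp
  then show ?thesis using k by linarith
qed

lemma kact_eq_iff [simp]: "kact n k v = kact m l v \<longleftrightarrow> n = m \<and> k = l"
  using kact_separated[of n k v m l] by auto

lemma dist_kact [simp]: "dist (kact n k u) (kact n k v) = dist u v"
proof -
  have "norm (kact n k u - kact n k v) = norm (u - v)"
    using flip_cases[of k] by (auto simp: norm_vec_def L2_set_def sum_2 power2_commute)
  then show ?thesis by (simp add: dist_norm)
qed

lemma continuous_kact [continuous_intros]:
  "continuous_on S f \<Longrightarrow> continuous_on S (\<lambda>x. kact n k (f x))"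
  unfolding aff_act_def klein_elt_def
  by (auto intro!: continuous_intros matrix_vector_mult_linear_continuous_on
     continuous_on_compose2[OF matrix_vector_mult_linear_continuous_on[of UNIV]])

definition fund_domain :: "(real^2) set" where
  "fund_domain = cbox (vector [0, 0]) (vector [1, 1/2])"

lemma mem_fund_domain: "v \<in> fund_domain \<longleftrightarrow> 0 \<le> v $ 1 \<and> v $ 1 \<le> 1 \<and> 0 \<le> v $ 2 \<and> v $ 2 \<le> 1/2"
  by (auto simp: fund_domain_def mem_box_cart forall_2)

lemma kact_into_fund_domain: obtains n k where "kact n k v \<in> fund_domain"
proof -
  define k where "k = - \<lfloor>2 * v $ 2\<rfloor>"
  define n where "n = - \<lfloor>of_int (flip k) * v $ 1\<rfloor>"
  have "kact n k v \<in> fund_domain"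
    unfolding mem_fund_domain n_def k_def kact_nth by (simp; linarith)
  then show ?thesis by (rule that)
qed

section \<open>The group inside the affine group\<close>

lemma group_Aff: "group (Aff :: ((real^'n) \<times> (real^'n^'n)) monoid)"
proof (rule groupI)
  fix x y z :: "(real^'n) \<times> (real^'n^'n)"
  assume x: "x \<in> carrier Aff" and y: "y \<in> carrier Aff"
  show "x \<otimes>\<^bsub>Aff\<^esub> y \<in> carrier Aff"
    using x y by (auto simp: Aff_def invertible_mult)
  show "x \<otimes>\<^bsub>Aff\<^esub> y \<otimes>\<^bsub>Aff\<^esub> z = x \<otimes>\<^bsub>Aff\<^esub> (y \<otimes>\<^bsub>Aff\<^esub> z)"
    by (auto simp: Aff_def matrix_mul_assoc matrix_vector_mul_assoc matrix_vector_right_distrib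
        split: prod.split)
  obtain v A where xe: "x = (v, A)" and A: "invertible A" using x by (auto simp: Aff_def)
  obtain B where B: "A ** B = mat 1" "B ** A = mat 1" using A by (auto simp: invertible_def)
  have "invertible B" using B by (auto simp: invertible_def)
  moreover have "(- (B *v v), B) \<otimes>\<^bsub>Aff\<^esub> x = \<one>\<^bsub>Aff\<^esub>"
    by (simp add: xe Aff_def B)
  ultimately show "\<exists>y\<in>carrier Aff. y \<otimes>\<^bsub>Aff\<^esub> x = \<one>\<^bsub>Aff\<^esub>"
    by (intro bexI[of _ "(- (B *v v), B)"]) (auto simp: Aff_def)
qed (auto simp: Aff_def invertible_def intro: exI[of _ "mat 1"])

lemma semidirect_sel [simp]:
  "carrier (semidirect F) = UNIV \<times> F" "\<one>\<^bsub>semidirect F\<^esub> = (0, mat 1)"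
  "(v, A) \<otimes>\<^bsub>semidirect F\<^esub> (w, B) = (v + A *v w, A ** B)"
  by (auto simp: semidirect_def Aff_def)

lemma subgroup_holonomy: "subgroup (UNIV \<times> holonomy) Aff"
proof (rule group.subgroupI[OF group_Aff])
  show "UNIV \<times> holonomy \<subseteq> carrier Aff"
    by (auto simp: Aff_def holonomy_def invertible_diag_mat)
  show "UNIV \<times> holonomy \<noteq> {}" by (simp add: holonomy_def)
next
  fix x :: "(real^2) \<times> (real^2^2)" assume x: "x \<in> UNIV \<times> holonomy"
  then obtain v A where xe: "x = (v, A)" and A: "A \<in> holonomy" by auto
  have AA: "A ** A = mat 1" using A by (auto simp: holonomy_def diag_mat_mult mat_1_eq_diag)
  then have inv: "invertible A" by (auto simp: invertible_def)
  have "inv\<^bsub>Aff\<^esub> x = (- (A *v v), A)"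
    by (rule group.inv_equality[OF group_Aff]) (auto simp: xe Aff_def AA inv)
  then show "inv\<^bsub>Aff\<^esub> x \<in> UNIV \<times> holonomy" using A by auto
next
  fix x y :: "(real^2) \<times> (real^2^2)" assume "x \<in> UNIV \<times> holonomy" "y \<in> UNIV \<times> holonomy"
  then show "x \<otimes>\<^bsub>Aff\<^esub> y \<in> UNIV \<times> holonomy"
    by (auto simp: Aff_def holonomy_def diag_mat_mult)
qed

lemma group_semidirect: "group (semidirect holonomy)"
  using group.subgroup_imp_group[OF group_Aff subgroup_holonomy] by (simp add: semidirect_def)

lemma klein_elt_0: "klein_elt 0 0 = \<one>\<^bsub>semidirect holonomy\<^esub>"
  by (simp add: klein_elt_def mat_1_eq_diag vec2_eq_iff)

lemma klein_elt_mult: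
  "klein_elt n k \<otimes>\<^bsub>semidirect F\<^esub> klein_elt m l = klein_elt (n + flip k * m) (k + l)"
  by (simp add: klein_elt_def diag_mat_mult diag_mat_vec flip_add vec2_eq_iff add_divide_distrib)

lemma klein_elt_carrier: "klein_elt n k \<in> carrier (semidirect holonomy)"
  by (auto simp: klein_elt_def holonomy_def flip_def)

lemma klein_elt_inv: "inv\<^bsub>semidirect holonomy\<^esub> klein_elt n k = klein_elt (- flip k * n) (- k)"
  by (rule group.inv_equality[OF group_semidirect _ klein_elt_carrier klein_elt_carrier])
    (simp add: klein_elt_mult klein_elt_0)

lemma subgroup_klein_group: "subgroup klein_group (semidirect holonomy)"
proof (rule group.subgroupI[OF group_semidirect])
  show "klein_group \<subseteq> carrier (semidirect holonomy)"
    using klein_elt_carrier by (auto simp del: semidirect_sel)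
qed (auto elim!: klein_group_cases simp: klein_elt_inv klein_elt_mult simp del: semidirect_sel)

lemma klein_elt_eq_iff [simp]: "klein_elt n k = klein_elt m l \<longleftrightarrow> n = m \<and> k = l"
  by (auto simp: klein_elt_def vec2_eq_iff)

lemma generate_klein_group:
  "generate (semidirect holonomy) {klein_elt 1 0, klein_elt 0 1} = klein_group"
    (is "?H = _")
proof
  show "?H \<subseteq> klein_group"
    by (rule group.generate_subgroup_incl[OF group_semidirect _ subgroup_klein_group])
      (auto simp: klein_group_def)
next
  have mult: "klein_elt (n + flip k * m) (k + l) \<in> ?H"
    if "klein_elt n k \<in> ?H" "klein_elt m l \<in> ?H" for n k m l
    using generate.eng[OF that] by (simp add: klein_elt_mult)
  have gens: "klein_elt 1 0 \<in> ?H" "klein_elt 0 1 \<in> ?H"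
      "klein_elt (-1) 0 \<in> ?H" "klein_elt 0 (-1) \<in> ?H"
    using generate.inv[of "klein_elt 1 0" "{klein_elt 1 0, klein_elt 0 1}" "semidirect holonomy"]
      generate.inv[of "klein_elt 0 1" "{klein_elt 1 0, klein_elt 0 1}" "semidirect holonomy"]
    by (auto intro: generate.incl simp: klein_elt_inv)
  have one: "klein_elt 0 0 \<in> ?H" unfolding klein_elt_0 by (rule generate.one)
  have n: "klein_elt n 0 \<in> ?H" for n
  proof (induction n rule: int_induct[where k = 0])
    case (step1 i) then show ?case using mult[OF step1(2) gens(1)] by simp
  next
    case (step2 i) then show ?case using mult[OF step2(2) gens(3)] by simp
  qed (rule one)
  have k: "klein_elt 0 k \<in> ?H" for k
  proof (induction k rule: int_induct[where k = 0])
    case (step1 i) then show ?case using mult[OF step1(2) gens(2)] by simp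
  next
    case (step2 i) then show ?case using mult[OF step2(2) gens(4)] by simp
  qed (rule one)
  show "klein_group \<subseteq> ?H"
    using mult[OF n k] by (auto simp: klein_group_def)
qed

text \<open>The second coordinate is additive, so it vanishes on torsion; what remains are the integer
  translations in the first coordinate.\<close>

lemma torsion_free_klein_group: "torsion_free (semidirect holonomy) klein_group"
  unfolding torsion_free_def
proof (intro ballI allI impI)
  fix \<gamma> and N :: nat
  assume "\<gamma> \<in> klein_group" and N: "N > 0 \<and> \<gamma> [^]\<^bsub>semidirect holonomy\<^esub> N = \<one>\<^bsub>semidirect holonomy\<^esub>"
  then obtain n k where g: "\<gamma> = klein_elt n k" by (auto simp: klein_group_def)
  have pow: "\<exists>m. \<gamma> [^]\<^bsub>semidirect holonomy\<^esub> M = klein_elt m (int M * k) \<and> (k = 0 \<longrightarrow> m = int M * n)"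
    for M :: nat
  proof (induction M)
    case 0
    have "\<gamma> [^]\<^bsub>semidirect holonomy\<^esub> (0::nat) = klein_elt 0 0"
      unfolding klein_elt_0 by (rule monoid.nat_pow_0[OF group.is_monoid[OF group_semidirect]])
    then show ?case by auto
  next
    case (Suc M)
    then obtain m where "\<gamma> [^]\<^bsub>semidirect holonomy\<^esub> M = klein_elt m (int M * k)"
        "k = 0 \<longrightarrow> m = int M * n" by blast
    then show ?case
      by (auto simp: monoid.nat_pow_Suc[OF group.is_monoid[OF group_semidirect]] g klein_elt_mult
          algebra_simps)
  qed
  obtain m where m: "klein_elt m (int N * k) = klein_elt 0 0" "k = 0 \<longrightarrow> m = int N * n"
    using pow[of N] N by (metis klein_elt_0)
  then have "k = 0" "n = 0" using N by auto
  then show "\<gamma> = \<one>\<^bsub>semidirect holonomy\<^esub>" by (simp only: g klein_elt_0)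
qed

lemma euclidean_derived_set_of: "euclidean derived_set_of S = {x. x islimpt S}"
  unfolding derived_set_of_def islimpt_def by auto

lemma discrete_klein_group: "discrete_in (semidirect_top holonomy) klein_group"
proof -
  have isolated: False if l: "\<gamma> islimpt klein_group" and "\<gamma> \<in> klein_group" for \<gamma>
  proof -
    from that(2)
    obtain n k where g: "\<gamma> = klein_elt n k" by (auto simp: klein_group_def)
    from l obtain \<delta> where d: "\<delta> \<in> klein_group" "\<delta> \<noteq> \<gamma>" "dist \<delta> \<gamma> < 1/2"
      unfolding islimpt_approachable by (meson half_gt_zero zero_less_one)
    then obtain m l where "\<delta> = klein_elt m l" by (auto simp: klein_group_def)
    moreover have "dist (fst \<delta>) (fst \<gamma>) < 1/2"
      using d(3) dist_fst_le[of \<delta> \<gamma>] by linarith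
    ultimately have "dist (kact m l 0) (kact n k 0) < 1/2"
      by (simp add: g aff_act_def klein_elt_def diag_mat_vec)
    then show False using d(2) g \<open>\<delta> = _\<close> kact_separated by auto
  qed
  have "klein_group \<inter> top_of_set (UNIV \<times> holonomy) derived_set_of klein_group = {}"
  proof -
    have False if "\<gamma> \<in> klein_group" "\<gamma> \<in> top_of_set (UNIV \<times> holonomy) derived_set_of klein_group" for \<gamma>
    proof -
      have "\<gamma> \<in> euclidean derived_set_of ((UNIV \<times> holonomy) \<inter> klein_group)"
        using that(2) by (simp only: derived_set_of_subtopology Int_iff)
      then have "\<gamma> islimpt ((UNIV \<times> holonomy) \<inter> klein_group)"
        by (simp only: euclidean_derived_set_of mem_Collect_eq)
      then show False using isolated[OF islimpt_subset[OF _ Int_lower2] that(1)] by metis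
    qed
    then show ?thesis by (simp only: disjoint_iff) metis
  qed
  moreover have "klein_group \<subseteq> UNIV \<times> holonomy"
    using subgroup.subset[OF subgroup_klein_group] by simp
  ultimately show ?thesis
    unfolding discrete_in_def semidirect_top_def
    by (simp add: subtopology_eq_discrete_topology)
qed

text \<open>Each coset has a representative over the compact fundamental domain.\<close>

lemma uniform_klein_group:
  "uniform_in (semidirect holonomy) (semidirect_top holonomy) klein_group"
proof -
  let ?G = "semidirect holonomy" and ?T = "semidirect_top holonomy"
  let ?q = "\<lambda>g. klein_group #>\<^bsub>?G\<^esub> g"
  have T: "topspace ?T = UNIV \<times> holonomy" by (simp add: semidirect_top_def)
  have "compactin ?T (fund_domain \<times> holonomy)"
    by (simp add: semidirect_top_def compactin_subtopology holonomy_def fund_domain_def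
        compact_Times finite_imp_compact Sigma_mono)
  then have "compactin (quotient_topology ?T ?q) (?q ` (fund_domain \<times> holonomy))"
    by (rule image_compactin[OF _ quotient_imp_continuous_map[OF quotient_map_quotient_topology]])
  moreover have "?q ` (fund_domain \<times> holonomy) = ?q ` (UNIV \<times> holonomy)"
  proof
    show "?q ` (UNIV \<times> holonomy) \<subseteq> ?q ` (fund_domain \<times> holonomy)"
    proof clarify
      fix v A assume A: "A \<in> holonomy"
      obtain n k where nk: "kact n k v \<in> fund_domain" by (rule kact_into_fund_domain)
      let ?g = "klein_elt n k \<otimes>\<^bsub>?G\<^esub> (v, A)"
      have g: "?g \<in> klein_group #>\<^bsub>?G\<^esub> (v, A)"
        unfolding r_coset_def by blast
      have eq: "klein_group #>\<^bsub>?G\<^esub> (v, A) = klein_group #>\<^bsub>?G\<^esub> ?g"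
        by (rule group.repr_independence[OF group_semidirect g _ subgroup_klein_group])
          (simp add: A)
      have "fst ?g \<in> fund_domain" "snd ?g \<in> holonomy"
        using nk A flip_cases[of k]
        by (auto simp: klein_elt_def aff_act_def holonomy_def diag_mat_mult)
      then show "?q (v, A) \<in> ?q ` (fund_domain \<times> holonomy)"
        unfolding eq by (intro imageI) (auto simp: mem_Times_iff)
    qed
  qed auto
  ultimately show ?thesis
    unfolding uniform_in_def compact_space_def by (simp add: T)
qed

section \<open>An embedding of the Klein bottle\<close>

abbreviation korb :: "real^2 \<Rightarrow> (real^2) set" where
  "korb \<equiv> aff_orbit klein_group"

abbreviation kspace :: "(real^2) set topology" where
  "kspace \<equiv> orbit_space klein_group"

lemma korb_def: "korb v = {kact n k v |n k. True}"
  by (auto simp: aff_orbit_def klein_group_def)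

lemma korb_eq_iff: "korb u = korb v \<longleftrightarrow> (\<exists>n k. u = kact n k v)"
proof
  assume "korb u = korb v"
  moreover have "u \<in> korb u" unfolding korb_def by (metis (mono_tags, lifting) kact_0 mem_Collect_eq)
  ultimately show "\<exists>n k. u = kact n k v" by (auto simp: korb_def)
next
  assume "\<exists>n k. u = kact n k v"
  then obtain n k where u: "u = kact n k v" by blast
  have "kact m l v = kact (m - flip l * flip k * n) (l - k) u" for m l
    unfolding u kact_kact by (simp add: flip_def)
  then have "korb v \<subseteq> korb u" unfolding korb_def by blast
  moreover have "korb u \<subseteq> korb v" unfolding korb_def u kact_kact by blast
  ultimately show "korb u = korb v" by blast
qed

lemma korb_kact [simp]: "korb (kact n k v) = korb v"
  by (auto simp: korb_eq_iff)

lemma topspace_kspace [simp]: "topspace kspace = range korb"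
  by (simp add: orbit_space_def)

lemma quotient_map_korb: "quotient_map euclidean kspace korb"
  unfolding orbit_space_def by (rule quotient_map_quotient_topology)

text \<open>Coordinates invariant under the group: \<open>b\<close> changes the signs of both \<open>sin (2\<pi>x)\<close> and
  \<open>cis (2\<pi>y)\<close>, so their product survives. Working with this map instead of the set of orbits makes
  the quotient a compact subset of a Euclidean space, where separation properties are inherited and
  the lifting theorems for covering spaces apply.\<close>

definition kemb :: "real^2 \<Rightarrow> real \<times> complex \<times> complex" where
  "kemb v = (cos (2 * pi * v $ 1), sin (2 * pi * v $ 1) *\<^sub>R cis (2 * pi * v $ 2), cis (4 * pi * v $ 2))"

lemma cos_sin_add_int_pi:
  "cos (x + pi * of_int k) = of_int (flip k) * cos x" "sin (x + pi * of_int k) = of_int (flip k) * sin x"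
  by (simp_all add: cos_add sin_add flip_def)

text \<open>The last coordinate determines \<open>y\<close> modulo \<open>1/2\<close>, say up to \<open>k/2\<close>; the middle one then compares
  \<open>sin (2\<pi>x)\<close> up to the sign \<open>flip k\<close>, and together with the cosine this determines \<open>x\<close> up to that
  sign and an integer.\<close>

lemma kemb_eq_iff: "kemb u = kemb v \<longleftrightarrow> korb u = korb v"
  unfolding korb_eq_iff
proof
  assume e: "kemb u = kemb v"
  then have "cos (4 * pi * u $ 2) = cos (4 * pi * v $ 2)" "sin (4 * pi * u $ 2) = sin (4 * pi * v $ 2)"
    by (auto simp: kemb_def complex_eq_iff)
  then obtain k where "4 * pi * u $ 2 = 4 * pi * v $ 2 + 2 * pi * of_int k"
    using sin_cos_eq_iff by blast
  then have "pi * (4 * u $ 2) = pi * (4 * v $ 2 + 2 * of_int k)" by (simp add: algebra_simps)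
  then have k: "u $ 2 = v $ 2 + of_int k / 2" by simp
  have "2 * pi * u $ 2 = 2 * pi * v $ 2 + pi * of_int k" by (simp add: k algebra_simps)
  then have c: "cis (2 * pi * u $ 2) = of_int (flip k) * cis (2 * pi * v $ 2)"
    by (simp add: complex_eq_iff cos_sin_add_int_pi)
  have "sin (2 * pi * u $ 1) * of_int (flip k) = sin (2 * pi * v $ 1)"
  proof -
    have "complex_of_real (sin (2 * pi * u $ 1) * of_int (flip k)) * cis (2 * pi * v $ 2) =
        of_real (sin (2 * pi * v $ 1)) * cis (2 * pi * v $ 2)"
      using e c by (simp add: kemb_def scaleR_conv_of_real)
    then have "complex_of_real (sin (2 * pi * u $ 1) * of_int (flip k)) = of_real (sin (2 * pi * v $ 1))"
      using cis_neq_zero mult_right_cancel by blast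
    then show ?thesis by (simp only: of_real_eq_iff)
  qed
  then have "sin (2 * pi * u $ 1) = sin (2 * pi * (of_int (flip k) * v $ 1))"
    using flip_cases[of k] by auto
  moreover have "cos (2 * pi * u $ 1) = cos (2 * pi * (of_int (flip k) * v $ 1))"
    using e flip_cases[of k] by (auto simp: kemb_def)
  ultimately obtain n where "2 * pi * u $ 1 = 2 * pi * (of_int (flip k) * v $ 1) + 2 * pi * of_int n"
    using sin_cos_eq_iff by blast
  then have "(2 * pi) * u $ 1 = (2 * pi) * (of_int (flip k) * v $ 1 + of_int n)"
    by (simp add: algebra_simps)
  then have "u $ 1 = of_int (flip k) * v $ 1 + of_int n" by simp
  then show "\<exists>n k. u = kact n k v" using k by (metis kact_nth vec2_eq_iff)
next
  assume "\<exists>n k. u = kact n k v"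
  then obtain n k where u: "u = kact n k v" by blast
  have y: "2 * pi * u $ 2 = 2 * pi * v $ 2 + pi * of_int k"
    "4 * pi * u $ 2 = 4 * pi * v $ 2 + 2 * pi * of_int k" by (simp_all add: u algebra_simps)
  have x: "2 * pi * u $ 1 = 2 * pi * (of_int (flip k) * v $ 1) + 2 * pi * of_int n"
    by (simp add: u algebra_simps)
  have "sin (2 * pi * u $ 1) = sin (2 * pi * (of_int (flip k) * v $ 1))"
    "cos (2 * pi * u $ 1) = cos (2 * pi * (of_int (flip k) * v $ 1))"
    using sin_cos_eq_iff x by blast+
  moreover have "cis (4 * pi * u $ 2) = cis (4 * pi * v $ 2)"
    using sin_cos_eq_iff y by (auto simp: complex_eq_iff)
  moreover have "cis (2 * pi * u $ 2) = of_int (flip k) * cis (2 * pi * v $ 2)"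
    by (simp add: complex_eq_iff cos_sin_add_int_pi y)
  ultimately show "kemb u = kemb v"
    using flip_cases[of k] by (auto simp: kemb_def)
qed

lemma continuous_on_kemb: "continuous_on S kemb"
  unfolding kemb_def by (intro continuous_intros)

lemma quotient_maps_same_fibres:
  assumes p: "quotient_map X Y p" and q: "quotient_map X Z q"
    and fib: "\<And>x y. x \<in> topspace X \<Longrightarrow> y \<in> topspace X \<Longrightarrow> p x = p y \<longleftrightarrow> q x = q y"
  obtains h where "homeomorphic_map Y Z h" "\<And>x. x \<in> topspace X \<Longrightarrow> h (p x) = q x"
proof -
  obtain h where h: "continuous_map Y Z h" "\<And>x. x \<in> topspace X \<Longrightarrow> h (p x) = q x"
    using quotient_map_lift_exists[OF p quotient_imp_continuous_map[OF q]] fib by metis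
  obtain g where g: "continuous_map Z Y g" "\<And>x. x \<in> topspace X \<Longrightarrow> g (q x) = p x"
    using quotient_map_lift_exists[OF q quotient_imp_continuous_map[OF p]] fib by metis
  have "homeomorphic_maps Y Z h g"
    unfolding homeomorphic_maps_def
    using h g quotient_imp_surjective_map[OF p] quotient_imp_surjective_map[OF q]
    by (metis (no_types, lifting) imageE)
  then show ?thesis using that h(2) homeomorphic_maps_map by blast
qed

lemma compact_fund_domain: "compact fund_domain"
  by (simp add: fund_domain_def)

lemma kemb_image_fund_domain: "kemb ` fund_domain = range kemb"
proof -
  have "kemb v \<in> kemb ` fund_domain" for v
    by (metis image_eqI kact_into_fund_domain kemb_eq_iff korb_kact)
  then show ?thesis by blast
qed

lemma compact_range_kemb: "compact (range kemb)"
  by (metis compact_continuous_image compact_fund_domain continuous_on_kemb kemb_image_fund_domain)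

lemma open_saturation: "open U \<Longrightarrow> open {v. \<exists>n k. kact n k v \<in> U}"
proof -
  assume "open U"
  then have "open (kact n k -` U)" for n k
    by (intro open_vimage) (auto intro: continuous_kact continuous_on_id)
  then have "open (\<Union>n k. kact n k -` U)" by blast
  moreover have "(\<Union>n k. kact n k -` U) = {v. \<exists>n k. kact n k v \<in> U}" by auto
  ultimately show ?thesis by simp
qed

text \<open>A saturated open set is the complement of the saturation of a compact piece of the
  fundamental domain, whose image is compact and hence closed.\<close>

lemma openin_kemb_image:
  assumes "open U" shows "openin (top_of_set (range kemb)) (kemb ` U)"
proof -
  let ?W = "{v. \<exists>n k. kact n k v \<in> U}"
  have "compact (fund_domain - ?W)"
    by (intro compact_diff compact_fund_domain open_saturation assms)
  then have cl: "closed (kemb ` (fund_domain - ?W))"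
    by (intro compact_imp_closed compact_continuous_image continuous_on_kemb)
  have "kemb ` U = range kemb \<inter> - kemb ` (fund_domain - ?W)"
  proof (intro equalityI subsetI)
    fix z assume "z \<in> kemb ` U"
    then obtain u where u: "u \<in> U" "z = kemb u" by blast
    have "z \<notin> kemb ` (fund_domain - ?W)"
      using u by (auto simp: kemb_eq_iff korb_eq_iff) blast
    then show "z \<in> range kemb \<inter> - kemb ` (fund_domain - ?W)" using u by blast
  next
    fix z assume z: "z \<in> range kemb \<inter> - kemb ` (fund_domain - ?W)"
    then obtain v where v: "v \<in> fund_domain" "z = kemb v"
      using kemb_image_fund_domain by auto
    then have "v \<in> ?W" using z by blast
    then obtain n k where nk: "kact n k v \<in> U" by blast
    have "kemb v = kemb (kact n k v)" by (simp add: kemb_eq_iff)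
    then show "z \<in> kemb ` U" using nk v by blast
  qed
  then show ?thesis using cl by (auto simp: openin_open)
qed

lemma quotient_map_kemb: "quotient_map euclidean (top_of_set (range kemb)) kemb"
  by (rule continuous_open_imp_quotient_map)
    (auto simp: open_map_def openin_kemb_image continuous_on_kemb continuous_map_in_subtopology)

lemma kspace_embedding:
  obtains h where "homeomorphic_map kspace (top_of_set (range kemb)) h" "\<And>v. h (korb v) = kemb v"
  using quotient_maps_same_fibres[OF quotient_map_korb quotient_map_kemb] kemb_eq_iff by auto

lemma kspace_homeomorphic: "kspace homeomorphic_space top_of_set (range kemb)"
  by (metis kspace_embedding homeomorphic_map_imp_homeomorphic_space)

lemma compact_kspace: "compact_space kspace"
  using homeomorphic_compact_space[OF kspace_homeomorphic] compact_range_kemb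
  by (simp add: compact_space_subtopology)

lemma Hausdorff_kspace: "Hausdorff_space kspace"
  using homeomorphic_Hausdorff_space[OF kspace_homeomorphic]
  by (simp add: Hausdorff_space_subtopology)

lemma openin_korb_image: "open U \<Longrightarrow> openin kspace (korb ` U)"
proof -
  assume "open U"
  moreover have "{v. korb v \<in> korb ` U} = {v. \<exists>n k. kact n k v \<in> U}"
    by (auto simp: korb_eq_iff image_iff) (metis korb_eq_iff korb_kact)+
  ultimately show ?thesis
    by (auto simp: orbit_space_def openin_quotient_topology open_saturation)
qed

lemma second_countable_kspace: "second_countable kspace"
proof (rule second_countable_open_map_image)
  show "continuous_map euclidean kspace korb"
    by (rule quotient_imp_continuous_map[OF quotient_map_korb])
  show "open_map euclidean kspace korb"
    by (simp add: open_map_def openin_korb_image)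
  obtain B :: "(real^2) set set" where "countable B" "topological_basis B"
    using ex_countable_basis by blast
  then show "second_countable (euclidean :: (real^2) topology)"
    unfolding second_countable_def
    by (intro exI[of _ B]) (auto simp: topological_basis_open elim!: topological_basisE)
qed simp

section \<open>The unit square model\<close>

text \<open>The square is the fundamental domain with the second coordinate doubled. The only pairs of its
  points in one orbit are those glued directly, by \<open>a\<close> on the vertical sides and by \<open>ab\<close> on the
  horizontal ones, and vertically adjacent corners, which need two gluing steps.\<close>

lemma kspace_homeomorphic_klein_bottle: "kspace homeomorphic_space klein_bottle"
proof -
  define R where "R = klein_glue \<union> klein_glue\<inverse>"
  define Q :: "(real \<times> real) set" where "Q = {0..1} \<times> {0..1}"
  define e where "e p = kemb (vector [fst p, snd p / 2])" for p
  have e_eq: "e p = e q \<longleftrightarrow>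
      (\<exists>n k. fst p = of_int (flip k) * fst q + of_int n \<and> snd p = snd q + of_int k)" for p q
    by (simp add: e_def kemb_eq_iff korb_eq_iff vec2_eq_iff field_simps)
  have R_e: "e p = e q" if "(p, q) \<in> R" for p q
  proof -
    have glue: "e p = e q" if pq: "(p, q) \<in> klein_glue" for p q
    proof -
      from pq consider "\<exists>t. p = (0, t) \<and> q = (1, t)" | "\<exists>s. p = (s, 0) \<and> q = (1 - s, 1)"
        unfolding klein_glue_def by blast
      then show ?thesis
      proof cases
        case 1 then show ?thesis
          unfolding e_eq by (elim exE, intro exI[of _ "-1"] exI[of _ 0]) simp
      next
        case 2 then show ?thesis
          unfolding e_eq by (elim exE, intro exI[of _ "1"] exI[of _ "-1"]) simp
      qed
    qed
    then show ?thesis using that unfolding R_def by (metis UnE converse_iff)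
  qed
  have Rs_e: "e p = e q" if "(p, q) \<in> R\<^sup>*" for p q
    using that by induction (auto simp: R_e)
  have symR: "sym (R\<^sup>*)" unfolding R_def by (intro sym_rtrancl) (auto simp: sym_def)
  have glue1: "((0, t), (1, t)) \<in> R\<^sup>*" if "0 \<le> t" "t \<le> 1" for t
    using that by (auto simp: R_def klein_glue_def)
  have glue2: "((s, 0), (1 - s, 1)) \<in> R\<^sup>*" if "0 \<le> s" "s \<le> 1" for s
    using that by (auto simp: R_def klein_glue_def)
  have e_R_nonneg: "(q, p) \<in> R\<^sup>*"
    if "p \<in> Q" "q \<in> Q" "fst p = of_int (flip k) * fst q + of_int n"
      "snd p = snd q + of_int k" "k \<ge> 0" for p q k n
  proof -
    obtain s t s' t' where pq: "p = (s', t')" "q = (s, t)" by (metis surj_pair)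
    have rng: "0 \<le> s" "s \<le> 1" "0 \<le> t" "t \<le> 1" "0 \<le> s'" "s' \<le> 1" "0 \<le> t'" "t' \<le> 1"
      using that(1,2) by (auto simp: Q_def pq)
    have s': "s' = of_int (flip k) * s + of_int n" and t': "t' = t + of_int k"
      using that(3,4) by (auto simp: pq)
    have "k = 0 \<or> k = 1" using that(5) t' rng by linarith
    then show ?thesis
    proof
      assume k: "k = 0"
      then have s: "s' = s + of_int n" and t: "t' = t" using s' t' by auto
      then have "n = 0 \<or> (n = 1 \<and> s = 0 \<and> s' = 1) \<or> (n = -1 \<and> s = 1 \<and> s' = 0)"
        using rng by linarith
      then show ?thesis
        using glue1[of t] symD[OF symR glue1[of t]] rng s t by (auto simp: pq)
    next
      assume k: "k = 1"
      then have s: "s' = of_int n - s" and t: "t = 0" "t' = 1" using s' t' rng by auto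
      then have "n = 1 \<or> (n = 0 \<and> s = 0 \<and> s' = 0) \<or> (n = 2 \<and> s = 1 \<and> s' = 1)"
        using rng by linarith
      moreover have "((0, 0), (0, 1)) \<in> R\<^sup>*"
        using glue2[of 0] symD[OF symR glue1[of 1]] by (auto intro: rtrancl_trans)
      moreover have "((1, 0), (1, 1)) \<in> R\<^sup>*"
        using glue2[of 1] glue1[of 1] by (auto intro: rtrancl_trans)
      ultimately show ?thesis using glue2[of s] s t rng by (auto simp: pq)
    qed
  qed
  have e_R: "(q, p) \<in> R\<^sup>*" if pq: "p \<in> Q" "q \<in> Q" "e p = e q" for p q
  proof -
    obtain n k where nk: "fst p = of_int (flip k) * fst q + of_int n" "snd p = snd q + of_int k"
      using pq(3) e_eq by blast
    show ?thesis
    proof (cases "k \<ge> 0")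
      case True then show ?thesis using e_R_nonneg pq nk by blast
    next
      case False
      have "(p, q) \<in> R\<^sup>*"
        using False nk flip_cases[of k]
        by (intro e_R_nonneg[OF pq(2,1), of "-k" "- flip k * n"]) auto
      then show ?thesis by (rule symD[OF symR])
    qed
  qed
  have "e ` Q = range kemb"
  proof -
    have "e ` Q = kemb ` fund_domain"
    proof (intro equalityI subsetI)
      fix z assume "z \<in> kemb ` fund_domain"
      then obtain v where v: "v \<in> fund_domain" "z = kemb v" by blast
      then have "z = e (v $ 1, 2 * v $ 2)" "(v $ 1, 2 * v $ 2) \<in> Q"
        by (auto simp: e_def Q_def mem_fund_domain intro!: arg_cong[where f = kemb]) (simp add: vec2_eq_iff)
      then show "z \<in> e ` Q" by blast
    qed (auto simp: e_def Q_def mem_fund_domain intro!: imageI)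
    then show ?thesis by (simp add: kemb_image_fund_domain)
  qed
  moreover have "continuous_on Q e"
    unfolding e_def kemb_def vector_2 by (intro continuous_intros) auto
  ultimately have qe: "quotient_map (top_of_set Q) (top_of_set (range kemb)) e"
    by (intro continuous_imp_quotient_map)
      (auto simp: compact_space_subtopology Q_def compact_Times Hausdorff_space_subtopology)
  have qR: "quotient_map (top_of_set Q) klein_bottle (\<lambda>p. R\<^sup>* `` {p})"
    unfolding klein_bottle_def R_def Q_def by (rule quotient_map_quotient_topology)
  have fib: "R\<^sup>* `` {p} = R\<^sup>* `` {q} \<longleftrightarrow> e p = e q" if "p \<in> Q" "q \<in> Q" for p q
  proof
    assume "R\<^sup>* `` {p} = R\<^sup>* `` {q}"
    then have "(q, p) \<in> R\<^sup>*" by blast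
    then show "e p = e q" using Rs_e by metis
  next
    assume "e p = e q"
    then have "(q, p) \<in> R\<^sup>*" "(p, q) \<in> R\<^sup>*" using e_R that by (metis, metis)
    then show "R\<^sup>* `` {p} = R\<^sup>* `` {q}" by (auto intro: rtrancl_trans)
  qed
  have "klein_bottle homeomorphic_space top_of_set (range kemb)"
    by (rule quotient_maps_same_fibres[OF qR qe])
      (simp_all add: fib homeomorphic_map_imp_homeomorphic_space)
  then show ?thesis
    using kspace_homeomorphic homeomorphic_space_sym homeomorphic_space_trans by blast
qed

section \<open>The covering of the Klein bottle by the plane\<close>

lemma kact_image_open: "open U \<Longrightarrow> open (kact n k ` U)"
proof -
  assume "open U"
  then have "open (kact (- flip k * n) (- k) -` U)"
    by (intro open_vimage) (auto intro: continuous_kact continuous_on_id)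
  moreover have "kact n k ` U = kact (- flip k * n) (- k) -` U"
  proof (intro equalityI subsetI)
    fix v assume "v \<in> kact (- flip k * n) (- k) -` U"
    moreover have "v = kact n k (kact (- flip k * n) (- k) v)"
      unfolding kact_kact by (simp flip: mult.assoc)
    ultimately show "v \<in> kact n k ` U" by blast
  qed (use kact_inverse in auto)
  ultimately show ?thesis by simp
qed

lemma inj_on_kemb_ball: "inj_on kemb (kact n k ` ball v (1/4))"
proof (intro inj_onI)
  fix x y assume x: "x \<in> kact n k ` ball v (1/4)" and y: "y \<in> kact n k ` ball v (1/4)"
    and "kemb x = kemb y"
  then obtain m l where x_y: "x = kact m l y" by (auto simp: kemb_eq_iff korb_eq_iff)
  have "dist x (kact n k v) < 1/4" "dist y (kact n k v) < 1/4"
    using x y by (auto simp: dist_commute)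
  then have "dist (kact m l y) (kact 0 0 y) < 1/2"
    unfolding x_y using dist_triangle_half_l[of "kact m l y" "kact n k v" "1/2" y] by (simp add: dist_commute)
  then have "m = 0 \<and> l = 0" by (rule kact_separated)
  then show "x = y" using x_y by simp
qed

text \<open>The sheets over the image of a ball of radius \<open>1/4\<close> are the translates of the ball; they are
  disjoint because translates of a point are \<open>1/2\<close> apart.\<close>

lemma covering_space_kemb: "covering_space UNIV kemb (range kemb)"
proof
  fix x assume "x \<in> range kemb"
  then obtain v where v: "x = kemb v" by blast
  define U where "U = ball v (1/4)"
  define \<V> where "\<V> = {kact n k ` U |n k. True}"
  show "\<exists>T. x \<in> T \<and> openin (top_of_set (range kemb)) T \<and>
          (\<exists>V. \<Union>V = UNIV \<inter> kemb -` T \<and> (\<forall>u\<in>V. openin (top_of_set UNIV) u) \<and>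
               pairwise disjnt V \<and> (\<forall>u\<in>V. \<exists>q. homeomorphism u T kemb q))"
  proof (intro exI[of _ "kemb ` U"] exI[of _ \<V>] conjI)
    show "x \<in> kemb ` U" by (auto simp: v U_def)
    show "openin (top_of_set (range kemb)) (kemb ` U)" by (simp add: U_def openin_kemb_image)
    show "\<Union>\<V> = UNIV \<inter> kemb -` kemb ` U"
    proof (intro equalityI subsetI)
      fix y assume "y \<in> UNIV \<inter> kemb -` kemb ` U"
      then obtain u where "u \<in> U" "kemb y = kemb u" by auto
      then obtain n k where "y = kact n k u" by (auto simp: kemb_eq_iff korb_eq_iff)
      then show "y \<in> \<Union>\<V>" using \<open>u \<in> U\<close> by (auto simp: \<V>_def)
    next
      fix y assume "y \<in> \<Union>\<V>"
      then obtain n k u where y: "y = kact n k u" and u: "u \<in> U" by (auto simp: \<V>_def)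
      have "kemb y = kemb u" by (simp add: kemb_eq_iff y)
      then show "y \<in> UNIV \<inter> kemb -` kemb ` U" using u by auto
    qed
    show "\<forall>u\<in>\<V>. openin (top_of_set UNIV) u"
      by (auto simp: \<V>_def U_def kact_image_open)
    show "pairwise disjnt \<V>"
    proof (intro pairwiseI)
      fix A B assume "A \<in> \<V>" "B \<in> \<V>" "A \<noteq> B"
      then obtain n k m l where AB: "A = kact n k ` U" "B = kact m l ` U"
        unfolding \<V>_def by blast
      show "disjnt A B"
      proof (rule ccontr)
        assume "\<not> disjnt A B"
        then obtain y z where yz: "y \<in> U" "z \<in> U" "kact n k y = kact m l z"
          by (auto simp: disjnt_def AB)
        have "dist (kact m l z) (kact n k z) = dist y z" using yz(3) dist_kact[of n k y z] by simp
        moreover have "dist y z < 1/2"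
          using yz dist_triangle_half_l[of y v "1/2" z] by (auto simp: U_def dist_commute)
        ultimately have "m = n \<and> l = k" using kact_separated by metis
        then show False using AB \<open>A \<noteq> B\<close> by simp
      qed
    qed
    show "\<forall>u\<in>\<V>. \<exists>q. homeomorphism u (kemb ` U) kemb q"
    proof
      fix u assume "u \<in> \<V>"
      then obtain n k where u: "u = kact n k ` U" by (auto simp: \<V>_def)
      have im: "kemb ` u = kemb ` U"
      proof -
        have "kemb (kact n k y) = kemb y" for y by (simp add: kemb_eq_iff)
        then show ?thesis by (simp add: u image_image)
      qed
      have op: "openin (top_of_set (kemb ` U)) (kemb ` W)" if "openin (top_of_set u) W" for W
      proof -
        have "open u" by (simp add: u U_def kact_image_open)
        then have "open W" "W \<subseteq> u" using that openin_open_eq by auto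
        then have "openin (top_of_set (range kemb)) (kemb ` W)" "kemb ` W \<subseteq> kemb ` U"
          using openin_kemb_image im by (blast, metis image_mono)
        then show ?thesis by (meson image_mono openin_subset_trans top_greatest)
      qed
      obtain q where "homeomorphism u (kemb ` U) kemb q"
        by (rule homeomorphism_injective_open_map[OF continuous_on_kemb im _ op])
          (simp add: u U_def inj_on_kemb_ball)
      then show "\<exists>q. homeomorphism u (kemb ` U) kemb q" by blast
    qed
  qed
qed (auto simp: continuous_on_kemb)

lemma lift_to_plane:
  fixes g :: "real^2 \<Rightarrow> (real^2) set"
  assumes g: "continuous_map euclidean kspace g"
  obtains H where "continuous_on UNIV H" "\<And>v. korb (H v) = g v"
proof -
  obtain h where h: "homeomorphic_map kspace (top_of_set (range kemb)) h" "\<And>v. h (korb v) = kemb v"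
    using kspace_embedding by blast
  have "continuous_map euclidean (top_of_set (range kemb)) (h \<circ> g)"
    by (rule continuous_map_compose[OF g homeomorphic_imp_continuous_map[OF h(1)]])
  then have c: "continuous_on UNIV (h \<circ> g)" "h \<circ> g \<in> UNIV \<rightarrow> range kemb"
    by (auto simp: continuous_map_in_subtopology)
  obtain H where H: "continuous_on UNIV H" "\<And>v. kemb (H v) = (h \<circ> g) v"
    using covering_space_lift[OF covering_space_kemb _ _ c]
    by (metis UNIV_I convex_UNIV convex_imp_locally_path_connected convex_imp_simply_connected)
  have "korb (H v) = g v" for v
  proof -
    have "g v \<in> topspace kspace" using continuous_map_image_subset_topspace[OF g] by auto
    then obtain w where w: "g v = korb w" by auto
    then show ?thesis using H(2)[of v] h(2) by (simp add: kemb_eq_iff)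
  qed
  then show ?thesis using that H(1) by blast
qed

text \<open>The element carrying one value to the other is locally constant because translates of a point
  are separated, hence constant on the connected plane.\<close>

lemma lifts_differ_by_kact:
  fixes f g :: "real^2 \<Rightarrow> real^2"
  assumes f: "continuous_on UNIV f" and g: "continuous_on UNIV g"
    and eq: "\<And>v. korb (f v) = korb (g v)"
  obtains n k where "\<And>v. f v = kact n k (g v)"
proof -
  obtain n k where nk: "f 0 = kact n k (g 0)" using eq korb_eq_iff by metis
  define S where "S = {v. f v = kact n k (g v)}"
  have "S = {v. dist (f v) (kact n k (g v)) < 1/2}"
  proof (intro equalityI subsetI)
    fix v assume v: "v \<in> {v. dist (f v) (kact n k (g v)) < 1/2}"
    obtain m l where "f v = kact m l (g v)" using eq korb_eq_iff by metis
    then show "v \<in> S" using v kact_separated[of m l "g v" n k] by (auto simp: S_def)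
  qed (auto simp: S_def)
  moreover have "open {v. dist (f v) (kact n k (g v)) < 1/2}"
    by (intro open_Collect_less continuous_intros f g)
  moreover have "closed S"
    unfolding S_def by (intro closed_Collect_eq continuous_intros f g)
  ultimately have "S = {} \<or> S = UNIV"
    by (metis clopen)
  then have "S = UNIV" using nk by (auto simp: S_def)
  then have "f v = kact n k (g v)" for v unfolding S_def by blast
  then show ?thesis by (rule that)
qed

section \<open>The flat structure on the Klein bottle\<close>

text \<open>Changes of charts and the iterates of the map are locally affine in the charts given by the
  covering. This property passes to directional derivatives, which are locally constant, so that
  smoothness follows by induction on the order.\<close>

definition locally_affine :: "('a::euclidean_space \<Rightarrow> 'b::real_normed_vector) \<Rightarrow> 'a set \<Rightarrow> bool" where
  "locally_affine f S \<longleftrightarrow>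
     (\<forall>x\<in>S. \<exists>U w L. open U \<and> x \<in> U \<and> bounded_linear L \<and> (\<forall>y\<in>U. f y = w + L y))"

lemma has_derivative_affine:
  assumes "open U" "x \<in> U" "bounded_linear L" "\<And>y. y \<in> U \<Longrightarrow> f y = w + L y"
  shows "(f has_derivative L) (at x)"
proof (rule has_derivative_transform_within_open[OF _ assms(1,2)])
  show "((\<lambda>y. w + L y) has_derivative L) (at x)"
    using has_derivative_add[OF has_derivative_const bounded_linear_imp_has_derivative[OF assms(3)]]
    by simp
qed (simp add: assms(4))

lemma smooth_on_locally_affine:
  assumes "locally_affine f S" shows "smooth_on f S"
proof -
  have "Ck_on k f S" for k
    using assms
  proof (induction k arbitrary: f)
    case 0
    have "isCont f x" if "x \<in> S" for x
      using 0 that has_derivative_affine has_derivative_continuous unfolding locally_affine_def by metis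
    then show ?case by (simp add: continuous_at_imp_continuous_on)
  next
    case (Suc k)
    have der: "\<exists>L. (f has_derivative L) (at x)" if "x \<in> S" for x
      using Suc.prems that has_derivative_affine unfolding locally_affine_def by metis
    have "locally_affine (\<lambda>x. frechet_derivative f (at x) v) S" for v
      unfolding locally_affine_def
    proof
      fix x assume "x \<in> S"
      then obtain U w L where U: "open U" "x \<in> U" "bounded_linear L" "\<forall>y\<in>U. f y = w + L y"
        using Suc.prems unfolding locally_affine_def by metis
      have "frechet_derivative f (at y) v = L v" if "y \<in> U" for y
        using has_derivative_affine[of U y L f w] U that by (metis frechet_derivative_at)
      then have "\<forall>y\<in>U. frechet_derivative f (at y) v = L v + (\<lambda>_. 0) y" by simp
      then show "\<exists>U w L. open U \<and> x \<in> U \<and> bounded_linear L \<and>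
          (\<forall>y\<in>U. frechet_derivative f (at y) v = w + L y)"
        using U(1,2) bounded_linear_zero by blast
    qed
    then have "\<forall>v. Ck_on k (\<lambda>x. frechet_derivative f (at x) v) S" using Suc.IH by blast
    moreover have "\<forall>x\<in>S. f differentiable (at x)" using der by (auto simp: differentiable_def)
    ultimately show ?case by simp
  qed
  then show ?thesis by (simp add: smooth_on_def)
qed

abbreviation kchart :: "(real^2) set \<Rightarrow> ((real^2) set, real^2) chart" where
  "kchart V \<equiv> (korb ` V, inv_into V korb)"

lemma kchart_cases:
  assumes "c \<in> orbit_atlas klein_group"
  obtains V where "c = kchart V" "open V" "inj_on korb V"
  using assms by (auto simp: orbit_atlas_def)

lemma chart_inv_kchart [simp]:
  "inj_on korb V \<Longrightarrow> y \<in> V \<Longrightarrow> inv_into (korb ` V) (inv_into V korb) y = korb y"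
  by (intro inv_into_f_eq inj_on_inv_into) auto

text \<open>The linear part of \<open>klein_elt n k\<close>.\<close>

definition klin :: "int \<Rightarrow> real^2 \<Rightarrow> real^2" where
  "klin k v = vector [of_int (flip k) * v $ 1, v $ 2]"

lemma klin_nth [simp]: "klin k v $ 1 = of_int (flip k) * v $ 1" "klin k v $ 2 = v $ 2"
  by (simp_all add: klin_def)

lemma bounded_linear_klin: "bounded_linear (klin k)"
  by (intro linear_conv_bounded_linear[THEN iffD1] linearI) (simp_all add: vec2_eq_iff algebra_simps)

lemma inner_klin [simp]: "klin k v \<bullet> klin k w = v \<bullet> w"
  using flip_cases[of k] by (auto simp: inner_vec_def sum_2)

lemma kact_affine: "kact n k (w + r *\<^sub>R y) = kact n k w + r *\<^sub>R klin k y"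
  by (simp add: vec2_eq_iff algebra_simps)

text \<open>The affine lift sends \<open>x\<close> into some translate of \<open>V'\<close>. By continuity the same translate
  serves all points near \<open>x\<close>, and injectivity on \<open>V'\<close> forces the chart to invert it there. Taking
  \<open>w = 0\<close> and \<open>r = 1\<close> covers the changes of charts.\<close>

lemma local_rep_kchart:
  assumes V: "open V" "inj_on korb V" and V': "open V'" "inj_on korb V'"
    and f: "\<And>y. f (korb y) = korb (w + r *\<^sub>R y)"
    and x: "x \<in> V" "f (korb x) \<in> korb ` V'"
  obtains n k U where "open U" "x \<in> U" "U \<subseteq> V"
    "\<And>y. y \<in> U \<Longrightarrow> f (korb y) \<in> korb ` V'"
    "\<And>y. y \<in> U \<Longrightarrow> local_rep f (kchart V) (kchart V') y = kact n k w + r *\<^sub>R klin k y"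
proof -
  obtain v' where v': "v' \<in> V'" "korb v' = korb (w + r *\<^sub>R x)" using x f by auto
  then obtain n k where nk: "v' = kact n k (w + r *\<^sub>R x)" using korb_eq_iff by blast
  define U where "U = V \<inter> (\<lambda>y. kact n k (w + r *\<^sub>R y)) -` V'"
  show ?thesis
  proof (rule that[of U n k])
    show "open U" unfolding U_def
      by (intro open_Int open_vimage V V' continuous_kact continuous_intros)
    show "x \<in> U" using v' nk x by (simp add: U_def)
    fix y assume y: "y \<in> U"
    have fy: "f (korb y) = korb (kact n k (w + r *\<^sub>R y))" by (simp add: f)
    then show "f (korb y) \<in> korb ` V'" using y by (simp add: U_def del: korb_kact)
    have "local_rep f (kchart V) (kchart V') y = inv_into V' korb (korb (kact n k (w + r *\<^sub>R y)))"
      using y V by (simp add: local_rep_def U_def fy del: korb_kact)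
    also have "\<dots> = kact n k (w + r *\<^sub>R y)"
      by (rule inv_into_f_f[OF V'(2)]) (use y in \<open>simp add: U_def\<close>)
    finally show "local_rep f (kchart V) (kchart V') y = kact n k w + r *\<^sub>R klin k y"
      by (simp only: kact_affine)
  qed (simp add: U_def)
qed

lemma smooth_on_local_rep:
  assumes c: "c \<in> orbit_atlas klein_group" and d: "d \<in> orbit_atlas klein_group"
    and f: "\<And>y. f (korb y) = korb (w + r *\<^sub>R y)"
  shows "smooth_on (local_rep f c d) (snd c ` {p \<in> fst c. f p \<in> fst d})"
proof (rule smooth_on_locally_affine)
  obtain V where V: "c = kchart V" "open V" "inj_on korb V" using c by (rule kchart_cases)
  obtain V' where V': "d = kchart V'" "open V'" "inj_on korb V'" using d by (rule kchart_cases)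
  show "locally_affine (local_rep f c d) (snd c ` {p \<in> fst c. f p \<in> fst d})"
    unfolding locally_affine_def
  proof
    fix x assume "x \<in> snd c ` {p \<in> fst c. f p \<in> fst d}"
    then obtain u where u: "u \<in> V" "f (korb u) \<in> korb ` V'" "x = inv_into V korb (korb u)"
      by (auto simp: V V')
    then have x: "x \<in> V" "f (korb x) \<in> korb ` V'" using V by auto
    obtain n k U where U: "open U" "x \<in> U"
        "\<And>y. y \<in> U \<Longrightarrow> local_rep f c d y = kact n k w + r *\<^sub>R klin k y"
      unfolding V(1) V'(1) using local_rep_kchart[OF V(2,3) V'(2,3) f x] by metis
    moreover have "bounded_linear (\<lambda>y. r *\<^sub>R klin k y)"
      using bounded_linear_klin bounded_linear_scaleR_right bounded_linear_compose by blast
    ultimately show "\<exists>U w L. open U \<and> x \<in> U \<and> bounded_linear L \<and> (\<forall>y\<in>U. local_rep f c d y = w + L y)"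
      by blast
  qed
qed

lemma tangent_rep_kchart:
  assumes c: "c \<in> orbit_atlas klein_group" and d: "d \<in> orbit_atlas klein_group"
    and f: "\<And>y. f (korb y) = korb (w + r *\<^sub>R y)"
    and p: "p \<in> fst c" "f p \<in> fst d"
  obtains k where "tangent_rep f c d p = (\<lambda>v. r *\<^sub>R klin k v)"
proof -
  obtain V where V: "c = kchart V" "open V" "inj_on korb V" using c by (rule kchart_cases)
  obtain V' where V': "d = kchart V'" "open V'" "inj_on korb V'" using d by (rule kchart_cases)
  obtain x where x: "x \<in> V" "p = korb x" using p V by auto
  have fx: "f (korb x) \<in> korb ` V'" using p x V' by auto
  obtain n k U where U: "open U" "x \<in> U"
      "\<And>y. y \<in> U \<Longrightarrow> local_rep f c d y = kact n k w + r *\<^sub>R klin k y"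
    unfolding V(1) V'(1) using local_rep_kchart[OF V(2,3) V'(2,3) f x(1) fx] by metis
  have "bounded_linear (\<lambda>y. r *\<^sub>R klin k y)"
    using bounded_linear_klin bounded_linear_scaleR_right bounded_linear_compose by blast
  then have "(local_rep f c d has_derivative (\<lambda>y. r *\<^sub>R klin k y)) (at x)"
    by (rule has_derivative_affine[OF U(1,2) _ U(3)])
  moreover have "snd c p = x" using x V by simp
  ultimately have "tangent_rep f c d p = (\<lambda>v. r *\<^sub>R klin k v)"
    unfolding tangent_rep_def by (metis frechet_derivative_at)
  then show ?thesis by (rule that)
qed

lemma inj_on_korb_ball: "inj_on korb (ball v (1/4))"
  using inj_on_kemb_ball[of 0 0 v] by (simp add: inj_on_def kemb_eq_iff)

lemma homeomorphic_map_kchart: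
  assumes V: "open V" "inj_on korb V"
  shows "homeomorphic_map (subtopology kspace (korb ` V)) (top_of_set V) (inv_into V korb)"
proof -
  let ?X = "subtopology kspace (korb ` V)"
  have top: "topspace ?X = korb ` V" by auto
  have "homeomorphic_map (top_of_set V) ?X korb"
  proof (rule bijective_open_imp_homeomorphic_map)
    show "continuous_map (top_of_set V) ?X korb"
      using quotient_imp_continuous_map[OF quotient_map_korb]
      by (auto simp: continuous_map_in_subtopology continuous_map_from_subtopology)
    show "open_map (top_of_set V) ?X korb"
      unfolding open_map_def
    proof (intro allI impI)
      fix U assume "openin (top_of_set V) U"
      then have "open U" "U \<subseteq> V" using V openin_open_eq by auto
      then have "openin kspace (korb ` U)" "korb ` U \<subseteq> korb ` V"
        by (auto intro: openin_korb_image)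
      then show "openin ?X (korb ` U)" by (auto simp: openin_subtopology)
    qed
  qed (use V top in auto)
  then obtain g where g: "homeomorphic_maps (top_of_set V) ?X korb g"
    using homeomorphic_map_maps by blast
  then have "homeomorphic_map ?X (top_of_set V) g"
    using homeomorphic_maps_map homeomorphic_maps_sym by blast
  moreover have "g p = inv_into V korb p" if "p \<in> topspace ?X" for p
    using g that V by (auto simp: homeomorphic_maps_def)
  ultimately show ?thesis by (rule homeomorphic_map_eq)
qed

lemma smooth_manifold_kspace: "smooth_manifold kspace (orbit_atlas klein_group)"
  unfolding smooth_manifold_def
proof (intro conjI ballI)
  show "(\<Union>c\<in>orbit_atlas klein_group. fst c) = topspace kspace"
  proof (intro equalityI subsetI)
    fix p assume "p \<in> topspace kspace"
    then obtain v where v: "p = korb v" by auto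
    have "kchart (ball v (1/4)) \<in> orbit_atlas klein_group"
      using inj_on_korb_ball by (auto simp: orbit_atlas_def)
    moreover have "p \<in> fst (kchart (ball v (1/4)))" by (auto simp: v)
    ultimately show "p \<in> (\<Union>c\<in>orbit_atlas klein_group. fst c)" by blast
  qed (auto simp: orbit_atlas_def)
next
  fix c assume c: "c \<in> orbit_atlas klein_group"
  then obtain V where V: "c = kchart V" "open V" "inj_on korb V" by (rule kchart_cases)
  show "openin kspace (fst c)" using V by (simp add: openin_korb_image)
  show "open (snd c ` fst c)" using V by (simp add: inv_into_image_cancel)
  show "homeomorphic_map (subtopology kspace (fst c)) (top_of_set (snd c ` fst c)) (snd c)"
    using homeomorphic_map_kchart V by (simp add: inv_into_image_cancel)
  fix d assume d: "d \<in> orbit_atlas klein_group"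
  have "smooth_on (local_rep id c d) (snd c ` {p \<in> fst c. id p \<in> fst d})"
    by (rule smooth_on_local_rep[OF c d, of id 0 1]) simp
  moreover have "{p \<in> fst c. id p \<in> fst d} = fst c \<inter> fst d" by auto
  ultimately show "smooth_on (snd d \<circ> chart_inv c) (snd c ` (fst c \<inter> fst d))"
    by (simp add: local_rep_def)
qed (rule Hausdorff_kspace second_countable_kspace)+

text \<open>The Euclidean inner product descends because the group acts by isometries.\<close>

lemma riemannian_metric_flat: "riemannian_metric (orbit_atlas klein_group) (\<lambda>c p v w. v \<bullet> w)"
  unfolding riemannian_metric_def
proof (intro conjI ballI allI impI)
  fix c d p and v w :: "real^2"
  assume "c \<in> orbit_atlas klein_group" "d \<in> orbit_atlas klein_group" "p \<in> fst c \<inter> fst d"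
  then obtain k where "tangent_rep id c d p = (\<lambda>v. 1 *\<^sub>R klin k v)"
    by (auto intro: tangent_rep_kchart[of c d id 0 1 p])
  then show "v \<bullet> w = tangent_rep id c d p v \<bullet> tangent_rep id c d p w" by simp
next
  fix c :: "((real^2) set, real^2) chart" and v w :: "real^2"
  show "smooth_on (\<lambda>x. v \<bullet> w) (snd c ` fst c)"
    by (rule smooth_on_locally_affine)
      (auto simp: locally_affine_def intro!: exI[of _ UNIV] exI[of _ "v \<bullet> w"] exI[of _ "\<lambda>_. 0"])
qed (auto simp: inner_commute bilinear_conv_bounded_bilinear bounded_bilinear_inner)

section \<open>The expanding map\<close>

text \<open>In the flat charts the differential of the \<open>j\<close>-th iterate is \<open>r\<^sup>j\<close> times an isometry, so that
  the constants \<open>C = 1\<close> and \<open>L = r\<close> serve.\<close>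

lemma expanding_map_homothety:
  assumes f: "\<And>v. f (korb v) = korb (w + r *\<^sub>R v)" and r: "r > 1"
  shows "expanding_map kspace (orbit_atlas klein_group) f"
proof -
  have iter: "\<exists>w'. \<forall>v. (f ^^ j) (korb v) = korb (w' + r ^ j *\<^sub>R v)" for j
  proof (induction j)
    case 0 show ?case by (intro exI[of _ 0]) simp
  next
    case (Suc j)
    then obtain w' where "\<forall>v. (f ^^ j) (korb v) = korb (w' + r ^ j *\<^sub>R v)" by blast
    then have "(f ^^ Suc j) (korb v) = korb ((w + r *\<^sub>R w') + r ^ Suc j *\<^sub>R v)" for v
      by (simp add: f algebra_simps)
    then show ?case by blast
  qed
  have "continuous_map euclidean kspace (\<lambda>v. korb (w + r *\<^sub>R v))"
  proof -
    have "continuous_map euclidean euclidean (\<lambda>v::real^2. w + r *\<^sub>R v)"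
      by (auto intro!: continuous_intros)
    from continuous_map_compose[OF this quotient_imp_continuous_map[OF quotient_map_korb]]
    show ?thesis by (simp add: comp_def)
  qed
  then have "continuous_map kspace kspace f"
    using continuous_compose_quotient_map[OF quotient_map_korb, of kspace f] by (simp add: comp_def f)
  then have "Ck_map 1 kspace (orbit_atlas klein_group) kspace (orbit_atlas klein_group) f"
    unfolding Ck_map_def using smooth_on_local_rep[OF _ _ f] unfolding smooth_on_def by blast
  moreover have "1 * r ^ j * sqrt (v \<bullet> v) \<le> (let u = tangent_rep (f ^^ j) c d p v in sqrt (u \<bullet> u))"
    if c: "c \<in> orbit_atlas klein_group" and d: "d \<in> orbit_atlas klein_group"
      and p: "p \<in> fst c" "(f ^^ j) p \<in> fst d" for j c d p and v :: "real^2"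
  proof -
    obtain w' where w': "\<And>v. (f ^^ j) (korb v) = korb (w' + r ^ j *\<^sub>R v)" using iter by metis
    obtain k where "tangent_rep (f ^^ j) c d p = (\<lambda>v. r ^ j *\<^sub>R klin k v)"
      using tangent_rep_kchart[OF c d w' p] by blast
    moreover have "norm (klin k v) = norm v" by (simp add: norm_eq_sqrt_inner)
    ultimately show ?thesis using r by (simp add: Let_def flip: norm_eq_sqrt_inner)
  qed
  ultimately show ?thesis
    unfolding expanding_map_def Let_def
    using compact_kspace smooth_manifold_kspace riemannian_metric_flat r
    by (intro conjI exI[of _ "\<lambda>c p v w. v \<bullet> w"] exI[of _ 1] exI[of _ r]) auto
qed

section \<open>Infra-nilmanifold endomorphisms\<close>

lemma kact_eq_klin: "kact n k v = klin k v + vector [of_int n, of_int k / 2]"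
  by (simp add: vec2_eq_iff)

text \<open>An automorphism preserving \<open>{0} \<times> F\<close> restricts to an additive map \<open>B\<close> of the plane that commutes
  with the reflection and hence preserves both axes. It sends \<open>a\<close> to \<open>a\<^sup>p\<close> and \<open>b\<close> to \<open>b\<^sup>q\<close>, without
  the factor \<open>a\<close> that distinguishes the affine map of the theorem; \<open>q\<close> is odd because the image of
  \<open>b\<close> has the same linear part as \<open>b\<close>.\<close>

lemma klein_endomorphism_lift:
  assumes "infra_nil_endomorphism holonomy klein_group f"
  obtains B q p where "continuous_on UNIV B" "odd q" "\<And>v. f (korb v) = korb (B v)"
    "\<And>n k v. B (kact n k v) = kact (p * n) (q * k) (B v)"
proof -
  let ?S = "diag_mat (-1) 1" and ?G = "semidirect holonomy"
  from assms obtain \<phi> where lie: "lie_automorphism holonomy \<phi>"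
    and F: "\<phi> ` ({0} \<times> holonomy) = {0} \<times> holonomy" and \<Gamma>: "\<phi> ` klein_group \<subseteq> klein_group"
    and f: "\<And>v. f (korb v) = korb (fst (\<phi> (v, mat 1)))"
    unfolding infra_nil_endomorphism_def by blast
  define B where "B v = fst (\<phi> (v, mat 1))" for v
  have iso: "\<phi> \<in> iso ?G ?G" using lie by (simp add: lie_automorphism_def)
  have \<phi>_hom: "\<phi> \<in> hom ?G ?G" using iso by (simp add: iso_def)
  have I: "mat 1 \<in> holonomy" "?S \<in> holonomy" by (simp_all add: holonomy_def mat_1_eq_diag)
  have hom: "\<phi> (v + A *v w, A ** C) = (fst (\<phi> (v, A)) + snd (\<phi> (v, A)) *v fst (\<phi> (w, C)),
      snd (\<phi> (v, A)) ** snd (\<phi> (w, C)))" if "A \<in> holonomy" "C \<in> holonomy" for v w A C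
  proof -
    have "\<phi> ((v, A) \<otimes>\<^bsub>?G\<^esub> (w, C)) = \<phi> (v, A) \<otimes>\<^bsub>?G\<^esub> \<phi> (w, C)"
      by (rule hom_mult[OF \<phi>_hom]) (simp_all add: that)
    also have "\<dots> = (fst (\<phi> (v, A)), snd (\<phi> (v, A))) \<otimes>\<^bsub>?G\<^esub> (fst (\<phi> (w, C)), snd (\<phi> (w, C)))"
      by simp
    finally show ?thesis by (simp only: semidirect_sel)
  qed
  have closed: "snd (\<phi> (v, A)) \<in> holonomy" if "A \<in> holonomy" for v A
  proof -
    have "\<phi> (v, A) \<in> carrier ?G"
      by (rule hom_in_carrier[OF \<phi>_hom]) (simp add: that)
    then show ?thesis by (simp add: mem_Times_iff)
  qed
  \<comment> \<open>Translations are squares, and squares have trivial linear part.\<close>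
  have snd_B: "snd (\<phi> (v, mat 1)) = mat 1" for v
  proof -
    let ?A = "snd (\<phi> ((1/2) *\<^sub>R v, mat 1))"
    have half: "(1/2) *\<^sub>R v + mat 1 *v ((1/2) *\<^sub>R v) = v" by (simp add: vec_eq_iff)
    have "snd (\<phi> (v, mat 1)) = ?A ** ?A"
      using hom[OF I(1) I(1), of "(1/2) *\<^sub>R v" "(1/2) *\<^sub>R v"]
      unfolding half by (simp only: matrix_mul_lid snd_conv)
    then show ?thesis
      using closed[OF I(1), of "(1/2) *\<^sub>R v"] by (auto simp: holonomy_def diag_mat_mult mat_1_eq_diag)
  qed
  have \<phi>_1: "\<phi> (v, mat 1) = (B v, mat 1)" for v
    by (simp add: B_def snd_B prod_eq_iff)
  have B_add: "B (v + w) = B v + B w" for v w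
    using hom[OF I(1) I(1), of v w] by (simp add: \<phi>_1)
  have B_0: "B 0 = 0" using B_add[of 0 0] by simp
  have \<phi>_S: "\<phi> (0, ?S) = (0, ?S)"
  proof -
    have "\<phi> (0, ?S) \<in> {0} \<times> holonomy" using F I(2) by blast
    moreover have "\<phi> (0, ?S) \<noteq> \<phi> (0, mat 1)"
    proof
      assume "\<phi> (0, ?S) = \<phi> (0, mat 1)"
      moreover have "inj_on \<phi> (carrier ?G)" using iso by (simp add: iso_def bij_betw_def)
      ultimately have "(0 :: real^2, ?S) = (0, mat 1)" using I by (auto dest: inj_onD)
      then show False by (simp add: mat_1_eq_diag)
    qed
    moreover have "\<phi> (0, mat 1) = (0, mat 1)" by (simp add: \<phi>_1 B_0)
    ultimately show ?thesis by (auto simp: holonomy_def mat_1_eq_diag)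
  qed
  \<comment> \<open>Conjugation by \<open>(0, ?S)\<close> acts on translations as the reflection.\<close>
  have \<phi>_vS: "\<phi> (v, ?S) = (B v, ?S)" for v
    using hom[OF I(1) I(2), of v 0] by (simp add: \<phi>_1 \<phi>_S)
  have B_klin: "B (klin k v) = klin k (B v)" for k v
  proof (cases "even k")
    case True then have "klin k = id" by (auto simp: vec2_eq_iff flip_def)
    then show ?thesis by simp
  next
    case False
    then have "klin k w = ?S *v w" for w by (simp add: vec2_eq_iff flip_def diag_mat_vec)
    moreover have "\<phi> (?S *v v, ?S) = (?S *v B v, ?S)"
      using hom[OF I(2) I(1), of 0 v] by (simp add: \<phi>_1 \<phi>_S)
    ultimately show ?thesis by (simp add: \<phi>_vS)
  qed
  have B_minus: "B (- v) = - B v" for v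
    using B_add[of v "- v"] by (simp add: B_0 eq_neg_iff_add_eq_0 add.commute)
  have B_int: "B (of_int n *\<^sub>R v) = of_int n *\<^sub>R B v" for n v
  proof (induction n rule: int_induct[where k = 0])
    case (step2 i)
    have "B (of_int (i - 1) *\<^sub>R v) = B (of_int i *\<^sub>R v + - v)" by (simp add: scaleR_diff_left)
    then show ?case using step2 unfolding B_add B_minus by (simp add: scaleR_diff_left)
  qed (simp_all add: B_0 B_add scaleR_add_left)
  let ?e1 = "vector [1, 0] :: real^2" and ?e2 = "vector [0, 1/2] :: real^2"
  have "klin 1 ?e1 = - ?e1" "klin 1 ?e2 = ?e2" by (simp_all add: vec2_eq_iff)
  then have Be: "klin 1 (B ?e1) = - B ?e1" "klin 1 (B ?e2) = B ?e2"
    by (metis B_klin B_minus, metis B_klin)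
  then have Be': "B ?e1 $ 2 = 0" "B ?e2 $ 1 = 0" by (simp_all add: vec2_eq_iff)
  have "klein_elt 1 0 = (?e1, mat 1)" "klein_elt 0 1 = (?e2, ?S)"
    by (simp_all add: klein_elt_def mat_1_eq_diag)
  then have mem: "(B ?e1, mat 1) \<in> klein_group" "(B ?e2, ?S) \<in> klein_group"
    using \<Gamma> klein_elt_mem[of 1 0] klein_elt_mem[of 0 1] \<phi>_1 \<phi>_vS by (metis image_subset_iff)+
  obtain p p' where "(B ?e1, mat 1 :: real^2^2) = klein_elt p p'" using mem(1) by (rule klein_group_cases)
  then have Be1: "B ?e1 = vector [of_int p, 0]"
    using Be' by (simp add: klein_elt_def vec2_eq_iff)
  obtain q' q where q: "(B ?e2, ?S) = klein_elt q' q" using mem(2) by (rule klein_group_cases)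
  then have Be2: "B ?e2 = vector [0, of_int q / 2]"
    using Be' by (simp add: klein_elt_def vec2_eq_iff)
  have "odd q" using q by (auto simp: klein_elt_def flip_def)
  show ?thesis
  proof (rule that[of B q p])
    show "odd q" by fact
    show "f (korb v) = korb (B v)" for v by (simp add: f B_def)
    show "B (kact n k v) = kact (p * n) (q * k) (B v)" for n k v
    proof -
      have "vector [of_int n, of_int k / 2] = of_int n *\<^sub>R ?e1 + of_int k *\<^sub>R ?e2"
        by (simp add: vec2_eq_iff)
      then have "B (vector [of_int n, of_int k / 2]) = vector [of_int (p * n), of_int (q * k) / 2]"
        by (simp add: B_add B_int Be1 Be2) (simp add: vec2_eq_iff)
      moreover have "klin k = klin (q * k)" using \<open>odd q\<close> by (auto simp: klin_def flip_def)
      ultimately show ?thesis unfolding kact_eq_klin B_add B_klin by simp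
    qed
    have "continuous_map (semidirect_top holonomy) (semidirect_top holonomy) \<phi>"
      using lie by (simp add: lie_automorphism_def diffeomorphism_def Ck_map_def)
    then have "continuous_on (UNIV \<times> holonomy) \<phi>"
      by (simp add: semidirect_top_def continuous_map_in_subtopology)
    then have "continuous_on UNIV (\<lambda>v. \<phi> (v, mat 1))"
      using I(1) by (rule_tac continuous_on_compose2[of _ \<phi>]) (auto intro!: continuous_intros)
    then show "continuous_on UNIV B" unfolding B_def by (rule continuous_on_fst)
  qed
qed

section \<open>Conjugacy and the action on the group modulo two\<close>

lemma lift_intertwines:
  assumes H: "continuous_on UNIV H" "\<And>v. korb (H v) = h (korb v)"
  obtains m l where "\<And>v. H (kact n k v) = kact m l (H v)"
proof (rule lifts_differ_by_kact[of "\<lambda>v. H (kact n k v)" H])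
  show "continuous_on UNIV (\<lambda>v. H (kact n k v))"
    by (rule continuous_on_compose2[OF H(1)]) (auto intro: continuous_kact continuous_on_id)
qed (use H in auto)

text \<open>The elements with both coordinates even are products of two squares, and lifts turn squares into
  squares.\<close>

lemma lift_intertwines_even:
  assumes H: "continuous_on UNIV H" "\<And>v. korb (H v) = h (korb v)"
  obtains m l where "\<And>v. H (kact (2 * n) (2 * k) v) = kact (2 * m) (2 * l) (H v)"
proof -
  have sq: "kact n k (kact n k v) = kact (2 * (if even k then n else 0)) (2 * k) v" for n k v
    by (simp add: kact_kact flip_def)
  obtain a b where ab: "\<And>v. H (kact n 0 v) = kact a b (H v)"
    using lift_intertwines[OF H] by blast
  obtain c d where cd: "\<And>v. H (kact 0 k v) = kact c d (H v)"
    using lift_intertwines[OF H] by blast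
  have "H (kact (2 * n) (2 * k) v) = H (kact n 0 (kact n 0 (kact 0 k (kact 0 k v))))" for v
    by (simp add: kact_kact)
  also have "\<dots> v = kact a b (kact a b (kact c d (kact c d (H v))))" for v
    by (simp only: ab cd)
  also have "\<dots> v = kact (2 * ((if even b then a else 0) + (if even d then c else 0))) (2 * (b + d)) (H v)" for v
    by (simp only: sq kact_kact) (simp add: flip_def)
  finally show ?thesis by (rule that)
qed

text \<open>Write \<open>\<psi>\<close> for the action on the group of the lift \<open>H\<close> of a conjugacy, and reduce modulo 2. With
  \<open>\<psi>(a) = (na, ka)\<close> and \<open>\<psi>(b) = (nb, kb)\<close>, comparing \<open>H \<circ> A\<close> with \<open>B \<circ> H\<close> along \<open>a \<mapsto> a\<^sup>3\<close> gives
  \<open>na = p na\<close>, and along \<open>b \<mapsto> ab\<^sup>3\<close> gives \<open>na + nb = p nb\<close> and \<open>ka + kb = q kb\<close>. As \<open>q\<close> is odd,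
  \<open>ka\<close> is even; whether \<open>p\<close> is even or odd, so is \<open>na\<close>. But a lift of the inverse homeomorphism
  would then send \<open>\<psi>(a)\<close>, a product of squares, to an even element, whereas it has to recover a
  conjugate of \<open>a\<close>.\<close>

lemma not_conjugate_infra_nil_endomorphism:
  assumes g: "\<And>v. g (korb v) = korb (A v)" and A: "continuous_on UNIV A"
    and A_kact: "\<And>n k v. A (kact n k v) = kact (3 * n + (if even k then 0 else 1)) (3 * k) (A v)"
    and f: "infra_nil_endomorphism holonomy klein_group f"
  shows "\<not> topologically_conjugate kspace g kspace f"
proof
  assume "topologically_conjugate kspace g kspace f"
  then obtain h where h: "homeomorphic_map kspace kspace h" and "\<forall>x\<in>range korb. h (g x) = f (h x)"
    by (auto simp: topologically_conjugate_def)
  then have hg: "h (g (korb v)) = f (h (korb v))" for v by blast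
  obtain h' where h': "homeomorphic_maps kspace kspace h h'"
    using h homeomorphic_map_maps by blast
  have c: "continuous_map kspace kspace h" "continuous_map kspace kspace h'"
    and h'h: "h' (h (korb v)) = korb v" for v
    using h' by (auto simp: homeomorphic_maps_def)
  have lift: "continuous_map euclidean kspace (\<lambda>v. i (korb v))" if "continuous_map kspace kspace i" for i
    using continuous_map_compose[OF quotient_imp_continuous_map[OF quotient_map_korb] that]
    by (simp add: comp_def)
  obtain H where H: "continuous_on UNIV H" "\<And>v. korb (H v) = h (korb v)"
    using lift_to_plane[OF lift[OF c(1)]] by blast
  obtain H' where H': "continuous_on UNIV H'" "\<And>v. korb (H' v) = h' (korb v)"
    using lift_to_plane[OF lift[OF c(2)]] by blast
  obtain B q p where B: "continuous_on UNIV B" and q: "odd q" and fB: "\<And>v. f (korb v) = korb (B v)"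
    and B_kact: "\<And>n k v. B (kact n k v) = kact (p * n) (q * k) (B v)"
    by (rule klein_endomorphism_lift[OF f], rule that)
  obtain na ka where a: "\<And>v. H (kact 1 0 v) = kact na ka (H v)"
    using lift_intertwines[OF H] by blast
  obtain nb kb where b: "\<And>v. H (kact 0 1 v) = kact nb kb (H v)"
    using lift_intertwines[OF H] by blast
  have "continuous_on UNIV (\<lambda>v. H (A v))" "continuous_on UNIV (\<lambda>v. B (H v))"
    using continuous_on_compose2[OF H(1) A] continuous_on_compose2[OF B H(1)] by auto
  moreover have "korb (H (A v)) = korb (B (H v))" for v
    by (metis H(2) fB g hg)
  ultimately obtain n0 k0 where HA: "\<And>v. H (A v) = kact n0 k0 (B (H v))"
    using lifts_differ_by_kact[of "\<lambda>v. H (A v)" "\<lambda>v. B (H v)"] by blast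
  have "kact na ka (kact na ka (kact na ka (kact n0 k0 (B (H 0))))) =
      kact n0 k0 (kact (p * na) (q * ka) (B (H 0)))"
  proof -
    have "H (A (kact 1 0 0)) = H (kact 1 0 (kact 1 0 (kact 1 0 (A 0))))"
      by (simp add: A_kact kact_kact)
    then show ?thesis by (simp only: a HA B_kact)
  qed
  then have ra: "even (na + flip ka * (na + flip ka * (na + flip ka * n0))) \<longleftrightarrow>
      even (n0 + flip k0 * (p * na))"
    unfolding kact_kact kact_eq_iff by metis
  have "kact na ka (kact nb kb (kact nb kb (kact nb kb (kact n0 k0 (B (H 0)))))) =
      kact n0 k0 (kact (p * nb) (q * kb) (B (H 0)))"
  proof -
    have "H (A (kact 0 1 0)) = H (kact 1 0 (kact 0 1 (kact 0 1 (kact 0 1 (A 0)))))"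
      by (simp add: A_kact kact_kact)
    then show ?thesis by (simp only: a b HA B_kact)
  qed
  then have rb: "even (na + flip ka * (nb + flip kb * (nb + flip kb * (nb + flip kb * n0)))) \<longleftrightarrow>
      even (n0 + flip k0 * (p * nb))"
      "even (ka + (kb + (kb + (kb + k0)))) \<longleftrightarrow> even (k0 + q * kb)"
    unfolding kact_kact kact_eq_iff by metis+
  have "even na" "even ka" using ra rb q by auto
  then obtain m l where "na = 2 * m" "ka = 2 * l" by (auto elim!: evenE)
  moreover obtain m' l' where H'2: "\<And>v. H' (kact (2 * m) (2 * l) v) = kact (2 * m') (2 * l') (H' v)"
    using lift_intertwines_even[OF H'] by blast
  ultimately have H'a: "H' (H (kact 1 0 v)) = kact (2 * m') (2 * l') (H' (H v))" for v
    by (simp only: a)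
  have "continuous_on UNIV (\<lambda>v. H' (H v))"
    using continuous_on_compose2[OF H'(1) H(1)] by auto
  moreover have "korb (H' (H v)) = korb v" for v by (simp only: H' H h'h)
  ultimately obtain n1 k1 where H'H: "\<And>v. H' (H v) = kact n1 k1 v"
    using lifts_differ_by_kact[of "\<lambda>v. H' (H v)" "\<lambda>v. v"] continuous_on_id by blast
  have "kact n1 k1 (kact 1 0 0) = kact (2 * m') (2 * l') (kact n1 k1 0)"
    using H'a[of 0] by (simp only: H'H)
  then have "even (n1 + flip k1 * 1) \<longleftrightarrow> even (2 * m' + flip (2 * l') * n1)"
    by (simp only: kact_kact kact_eq_iff)
  then show False by simp
qed

theorem mainTheorem3:
  fixes F :: "(real^2^2) set" and \<Gamma> :: "((real^2) \<times> (real^2^2)) set"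
    and a b \<alpha> :: "(real^2) \<times> (real^2^2)"
  assumes F: "F = {vector [vector [1, 0], vector [0, 1]], vector [vector [-1, 0], vector [0, 1]]}"
    and a: "a = (vector [1, 0], vector [vector [1, 0], vector [0, 1]])"
    and b: "b = (vector [0, 1/2], vector [vector [-1, 0], vector [0, 1]])"
    and \<Gamma>: "\<Gamma> = generate (semidirect F) {a, b}"
    and \<alpha>: "\<alpha> \<in> carrier Aff" "\<And>x y. aff_act \<alpha> (vector [x, y]) = vector [3 * x + 1/2, 3 * y]"
  shows "subgroup (UNIV \<times> F) Aff \<and>
    subgroup \<Gamma> (semidirect F) \<and>
    torsion_free (semidirect F) \<Gamma> \<and>
    discrete_in (semidirect_top F) \<Gamma> \<and>
    uniform_in (semidirect F) (semidirect_top F) \<Gamma> \<and>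
    orbit_space \<Gamma> homeomorphic_space klein_bottle \<and>
    (\<lambda>\<gamma>. \<alpha> \<otimes>\<^bsub>Aff\<^esub> \<gamma> \<otimes>\<^bsub>Aff\<^esub> inv\<^bsub>Aff\<^esub> \<alpha>) ` \<Gamma> \<subseteq> \<Gamma> \<and>
    (\<forall>v. induced_map \<Gamma> (aff_act \<alpha>) (aff_orbit \<Gamma> v) = aff_orbit \<Gamma> (aff_act \<alpha> v)) \<and>
    expanding_map (orbit_space \<Gamma>) (orbit_atlas \<Gamma>) (induced_map \<Gamma> (aff_act \<alpha>)) \<and>
    (\<forall>f. infra_nil_endomorphism F \<Gamma> f \<longrightarrow>
           \<not> topologically_conjugate (orbit_space \<Gamma>) (induced_map \<Gamma> (aff_act \<alpha>)) (orbit_space \<Gamma>) f)"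
proof -
  have F': "F = holonomy" by (simp add: F holonomy_def)
  have "a = klein_elt 1 0" "b = klein_elt 0 1" by (simp_all add: a b klein_elt_def)
  then have \<Gamma>': "\<Gamma> = klein_group" using generate_klein_group by (simp add: \<Gamma> F')
  have act: "aff_act \<alpha> v = vector [1/2, 0] + 3 *\<^sub>R v" for v
  proof -
    have v: "vector [v $ 1, v $ 2] = v" by (simp add: vec2_eq_iff)
    show ?thesis using \<alpha>(2)[of "v $ 1" "v $ 2"] unfolding v by (simp add: vec2_eq_iff)
  qed
  have act_nth: "aff_act \<alpha> v $ 1 = 3 * v $ 1 + 1/2" "aff_act \<alpha> v $ 2 = 3 * v $ 2" for v
    by (simp_all add: act)
  have act_kact: "aff_act \<alpha> (kact n k v) =
      kact (3 * n + (if even k then 0 else 1)) (3 * k) (aff_act \<alpha> v)" for n k v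
    by (simp add: vec2_eq_iff act_nth flip_def algebra_simps)
  obtain w M where wM: "\<alpha> = (w, M)" by (cases \<alpha>)
  have w: "w = vector [1/2, 0]" using act[of 0] by (simp add: wM aff_act_def)
  have "M *v v = diag_mat 3 3 *v v" for v
    using act[of v] by (simp add: wM w aff_act_def diag_mat_vec vec2_eq_iff)
  then have M: "M = diag_mat 3 3" by (simp add: matrix_eq)
  have conj: "\<alpha> \<otimes>\<^bsub>Aff\<^esub> klein_elt n k \<otimes>\<^bsub>Aff\<^esub> inv\<^bsub>Aff\<^esub> \<alpha> =
      klein_elt (3 * n + (if even k then 0 else 1)) (3 * k)" for n k
  proof -
    let ?\<gamma> = "klein_elt (3 * n + (if even k then 0 else 1)) (3 * k)"
    have carr: "klein_elt n k \<in> carrier Aff" for n k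
      using klein_elt_carrier[of n k] subgroup.subset[OF subgroup_holonomy] by auto
    have "\<alpha> \<otimes>\<^bsub>Aff\<^esub> klein_elt n k = ?\<gamma> \<otimes>\<^bsub>Aff\<^esub> \<alpha>"
      by (simp add: Aff_def wM w M klein_elt_def diag_mat_mult diag_mat_vec vec2_eq_iff flip_def)
    moreover have "\<alpha> \<otimes>\<^bsub>Aff\<^esub> klein_elt n k \<in> carrier Aff"
      by (intro monoid.m_closed[OF group.is_monoid[OF group_Aff]] \<alpha>(1) carr)
    ultimately show ?thesis
      using group.inv_solve_right[OF group_Aff carr _ \<alpha>(1)] by metis
  qed
  have desc: "induced_map klein_group (aff_act \<alpha>) (korb v) = korb (aff_act \<alpha> v)" for v
  proof -
    have "korb (aff_act \<alpha> u) = korb (aff_act \<alpha> v)" if "u \<in> korb v" for u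
      using that unfolding korb_def[of v] by (auto simp: act_kact simp del: kact_nth)
    moreover have "v \<in> korb v" unfolding korb_def by (metis (mono_tags, lifting) kact_0 mem_Collect_eq)
    ultimately show ?thesis unfolding induced_map_def by blast
  qed
  have "continuous_on UNIV (aff_act \<alpha>)"
    unfolding act by (intro continuous_intros)
  then have "\<forall>f. infra_nil_endomorphism holonomy klein_group f \<longrightarrow>
      \<not> topologically_conjugate kspace (induced_map klein_group (aff_act \<alpha>)) kspace f"
    using not_conjugate_infra_nil_endomorphism[OF desc _ act_kact] by blast
  moreover have "expanding_map kspace (orbit_atlas klein_group) (induced_map klein_group (aff_act \<alpha>))"
  proof (rule expanding_map_homothety)
    show "induced_map klein_group (aff_act \<alpha>) (korb v) = korb (vector [1/2, 0] + 3 *\<^sub>R v)" for v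
      by (simp only: desc act)
  qed simp
  moreover have "(\<lambda>\<gamma>. \<alpha> \<otimes>\<^bsub>Aff\<^esub> \<gamma> \<otimes>\<^bsub>Aff\<^esub> inv\<^bsub>Aff\<^esub> \<alpha>) ` klein_group \<subseteq> klein_group"
    by (auto elim!: klein_group_cases simp: conj)
  ultimately show ?thesis
    unfolding F' \<Gamma>'
    using subgroup_holonomy subgroup_klein_group torsion_free_klein_group discrete_klein_group
      uniform_klein_group kspace_homeomorphic_klein_bottle desc
    by blast
qed

end
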